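(* There is a computable group $\mathcal G$ which is left-orderable, but such that no computable group isomorphic to $\mathcal G$ admits a computable left-ordering.
   Context: A computable group is a group whose domain is $\omega$ and whose group operation is a computable function $\omega\times\omega\to\omega$; a computable presentation (computable copy) of a group is a computable group isomorphic to it. A left-ordering of a group $\mathcal G$ is a linear order $\leq$ on $\mathcal G$ such that $a\leq b$ implies $ca\leq cb$ for all $a,b,c\in\mathcal G$; a group is left-orderable if it admits a left-ordering. A left-ordering of a computable group is computable if it is a computable relation on $\omega$. *)

theory Defs
  imports "HOL-Algebra.Group"
begin

text \<open>
  Computability is in the sense of Kleene's partial recursive functions. Programs carry no
  arity: each program denotes one partial recursive function for every length of the argument
  list, diverging wherever a constituent gets a list of unsuitable length. In \<open>PrimRec f g\<close>
  and \<open>Mu f\<close> the recursion or search variable comes first; \<open>g\<close> receives the counter, the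
  previous value and the parameters, in this order.
\<close>

datatype recf =
    Zero
  | Succ
  | Proj nat
  | Comp recf "recf list"
  | PrimRec recf recf
  | Mu recf

text \<open>\<open>rec_eval r xs y\<close>: the program \<open>r\<close> halts on input \<open>xs\<close> with output \<open>y\<close>.\<close>

inductive rec_eval :: "recf \<Rightarrow> nat list \<Rightarrow> nat \<Rightarrow> bool" where
  Zero: "rec_eval Zero xs 0"
| Succ: "rec_eval Succ [x] (Suc x)"
| Proj: "i < length xs \<Longrightarrow> rec_eval (Proj i) xs (xs ! i)"
| Comp: "list_all2 (\<lambda>g y. rec_eval g xs y) gs ys \<Longrightarrow> rec_eval f ys z
    \<Longrightarrow> rec_eval (Comp f gs) xs z"
| PrimRec_0: "rec_eval f xs y \<Longrightarrow> rec_eval (PrimRec f g) (0 # xs) y"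
| PrimRec_Suc: "rec_eval (PrimRec f g) (n # xs) u \<Longrightarrow> rec_eval g (n # u # xs) y
    \<Longrightarrow> rec_eval (PrimRec f g) (Suc n # xs) y"
| Mu: "rec_eval f (n # xs) 0 \<Longrightarrow> \<forall>m<n. \<exists>v>0. rec_eval f (m # xs) v
    \<Longrightarrow> rec_eval (Mu f) xs n"

inductive_cases rec_eval_ZeroE: "rec_eval Zero xs y"
inductive_cases rec_eval_SuccE: "rec_eval Succ xs y"
inductive_cases rec_eval_ProjE: "rec_eval (Proj i) xs y"
inductive_cases rec_eval_CompE: "rec_eval (Comp f gs) xs y"
inductive_cases rec_eval_PrimRec_0E: "rec_eval (PrimRec f g) (0 # xs) y"
inductive_cases rec_eval_PrimRec_SucE: "rec_eval (PrimRec f g) (Suc n # xs) y"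
inductive_cases rec_eval_MuE: "rec_eval (Mu f) xs y"

lemma rec_eval_deterministic:
  "rec_eval r xs y \<Longrightarrow> rec_eval r xs z \<Longrightarrow> y = z"
proof (induction r xs y arbitrary: z rule: rec_eval.induct)
  case (Zero xs)
  then show ?case by (rule rec_eval_ZeroE) simp
next
  case (Succ x)
  then show ?case by (rule rec_eval_SuccE) simp
next
  case (Proj i xs)
  from Proj.prems show ?case by (rule rec_eval_ProjE) simp
next
  case (Comp xs gs ys f w)
  from Comp.prems obtain ys' where
    ys': "list_all2 (\<lambda>g y. rec_eval g xs y) gs ys'" and f: "rec_eval f ys' z"
    by (rule rec_eval_CompE)
  have "ys = ys'"
    using Comp.IH(1) ys' by (auto simp: list_all2_conv_all_nth intro!: nth_equalityI)
  then show ?case using Comp.IH(2) f by simp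
next
  case (PrimRec_0 f xs y g)
  from PrimRec_0.prems show ?case by (rule rec_eval_PrimRec_0E) (rule PrimRec_0.IH)
next
  case (PrimRec_Suc f g n xs u y)
  from PrimRec_Suc.prems obtain u' where
    "rec_eval (PrimRec f g) (n # xs) u'" "rec_eval g (n # u' # xs) z"
    by (rule rec_eval_PrimRec_SucE)
  then show ?case using PrimRec_Suc.IH by blast
next
  case (Mu f n xs)
  from Mu.prems have z: "rec_eval f (z # xs) 0" "\<forall>m<z. \<exists>v>0. rec_eval f (m # xs) v"
    by (blast elim: rec_eval_MuE)+
  show ?case
  proof (rule linorder_cases[of n z])
    assume "n < z"
    then obtain v where "v > 0" "rec_eval f (n # xs) v" using z(2) by blast
    then show ?thesis using Mu.IH(1) by blast
  next
    assume "z < n"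
    then obtain v where "v > 0" "\<And>w. rec_eval f (z # xs) w \<Longrightarrow> v = w" using Mu.IH(2) by blast
    then show ?thesis using z(1) by blast
  qed
qed

definition computable_binop :: "(nat \<Rightarrow> nat \<Rightarrow> nat) \<Rightarrow> bool" where
  "computable_binop f \<longleftrightarrow> (\<exists>r. \<forall>x y. rec_eval r [x, y] (f x y))"

definition computable_rel :: "nat rel \<Rightarrow> bool" where
  "computable_rel R \<longleftrightarrow> computable_binop (\<lambda>x y. if (x, y) \<in> R then 1 else 0)"

definition computable_group :: "nat monoid \<Rightarrow> bool" where
  "computable_group G \<longleftrightarrow> group G \<and> carrier G = UNIV \<and> computable_binop (mult G)"

definition left_ordering :: "('a, 'b) monoid_scheme \<Rightarrow> 'a rel \<Rightarrow> bool" where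
  "left_ordering G R \<longleftrightarrow> linear_order_on (carrier G) R \<and>
     (\<forall>a\<in>carrier G. \<forall>b\<in>carrier G. \<forall>c\<in>carrier G.
        (a, b) \<in> R \<longrightarrow> (c \<otimes>\<^bsub>G\<^esub> a, c \<otimes>\<^bsub>G\<^esub> b) \<in> R)"

definition left_orderable :: "('a, 'b) monoid_scheme \<Rightarrow> bool" where
  "left_orderable G \<longleftrightarrow> (\<exists>R. left_ordering G R)"

end

theory Submission
  imports
    Defs
    "HOL-Library.Nat_Bijection"
    "HOL-Library.Infinite_Set"
    "HOL-Library.Poly_Mapping"
    "HOL-Library.Product_Lexorder"
begin

text \<open>
  The group is a central extension in the style of P. Hall. Let \<open>t\<close> act by a shift on two free abelian
  groups with bases \<open>a\<^sub>i = t\<^sup>i a t\<^sup>-\<^sup>i\<close> and \<open>b\<^sub>j = t\<^sup>j b t\<^sup>-\<^sup>j\<close> (\<open>i, j\<close> integers), and let \<open>[a\<^sub>i, b\<^sub>j]\<close> be a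
  central element \<open>c\<close> depending only on \<open>i - j\<close>. These central elements can be chosen arbitrarily in
  an abelian group, and the group is generated by \<open>a, b, t\<close>. We take \<open>c\<^sub>0 = w\<close> and, for a program \<open>n\<close>
  that on input \<open>n\<close> halts with output 0 or 1, we let \<open>c\<close> at \<open>n + 1\<close> be \<open>w\<^sup>p\<close> or \<open>w\<^sup>-\<^sup>p\<close>, where \<open>p\<close> grows
  fast with the halting time; the remaining \<open>c\<close> are independent. A late halting cannot be noticed
  by a short word, so the word problem is decidable. The group is left-ordered lexicographically.
  In a computable copy with a computable left-ordering, the signs of the commutators
  \<open>[t\<^sup>n a t\<^sup>-\<^sup>n, b]\<close> relative to \<open>w\<close> are computable, but they disagree with every recursive function by
  diagonalisation.
\<close>

section \<open>Recursive functions\<close>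

abbreviation pfst :: "nat \<Rightarrow> nat" where "pfst z \<equiv> fst (prod_decode z)"
abbreviation psnd :: "nat \<Rightarrow> nat" where "psnd z \<equiv> snd (prod_decode z)"

lemma rec_eval_Comp1:
  "rec_eval g xs a \<Longrightarrow> rec_eval f [a] z \<Longrightarrow> rec_eval (Comp f [g]) xs z"
  by (rule rec_eval.Comp[where ys = "[a]"]) auto

lemma rec_eval_Comp2:
  "rec_eval g xs a \<Longrightarrow> rec_eval h xs b \<Longrightarrow> rec_eval f [a, b] z \<Longrightarrow> rec_eval (Comp f [g, h]) xs z"
  by (rule rec_eval.Comp[where ys = "[a, b]"]) auto

lemma rec_eval_Proj_eq: "i < length xs \<Longrightarrow> xs ! i = y \<Longrightarrow> rec_eval (Proj i) xs y"
  using rec_eval.Proj by blast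

section \<open>Programs for arithmetic and for pairing\<close>

definition add_prog :: recf where
  "add_prog = PrimRec (Proj 0) (Comp Succ [Proj 1])"

text \<open>The recursion variable comes first, so the first argument is subtracted from the second;
  the premises of \<open>recursive_sub\<close> inherit this order.\<close>

definition sub_prog :: recf where
  "sub_prog = PrimRec (Proj 0) (Comp (PrimRec Zero (Proj 0)) [Proj 1])"

definition triangle_prog :: recf where
  "triangle_prog = PrimRec Zero (Comp Succ [Comp add_prog [Proj 0, Proj 1]])"

definition pair_prog :: recf where
  "pair_prog = Comp add_prog [Comp triangle_prog [add_prog], Proj 0]"

text \<open>Searches for the least \<open>s\<close> with \<open>triangle (Suc s) > z\<close>. For
  \<open>z = prod_encode (x, y)\<close> this is \<open>x + y\<close>, since \<open>z\<close> lies
  \<open>x\<close> beyond \<open>triangle (x + y)\<close>.\<close>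

definition root_prog :: recf where
  "root_prog = Mu (Comp sub_prog [Comp triangle_prog [Comp Succ [Proj 0]], Comp Succ [Proj 1]])"

definition fst_prog :: recf where
  "fst_prog = Comp sub_prog [Comp triangle_prog [root_prog], Proj 0]"

definition snd_prog :: recf where
  "snd_prog = Comp sub_prog [fst_prog, root_prog]"

lemma add_prog: "rec_eval add_prog [n, m] (n + m)"
proof (induction n)
  case 0
  then show ?case unfolding add_prog_def
    by (auto intro!: rec_eval.PrimRec_0 rec_eval_Proj_eq)
next
  case (Suc n)
  then show ?case unfolding add_prog_def
    by (auto intro!: rec_eval.PrimRec_Suc rec_eval_Comp1 rec_eval_Proj_eq rec_eval.Succ)
qed

lemma pred_prog: "rec_eval (PrimRec Zero (Proj 0)) [n] (n - 1)"
proof (induction n)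
  case 0
  then show ?case by (auto intro!: rec_eval.PrimRec_0 rec_eval.Zero)
next
  case (Suc n)
  then show ?case by (auto intro!: rec_eval.PrimRec_Suc rec_eval_Proj_eq)
qed

lemma sub_prog: "rec_eval sub_prog [n, m] (m - n)"
proof (induction n)
  case 0
  then show ?case unfolding sub_prog_def
    by (auto intro!: rec_eval.PrimRec_0 rec_eval_Proj_eq)
next
  case (Suc n)
  have "rec_eval (Comp (PrimRec Zero (Proj 0)) [Proj 1]) [n, m - n, m] ((m - n) - 1)"
    by (rule rec_eval_Comp1[OF _ pred_prog]) (auto intro!: rec_eval_Proj_eq)
  then show ?case using Suc unfolding sub_prog_def
    by (auto intro!: rec_eval.PrimRec_Suc)
qed

lemma triangle_prog: "rec_eval triangle_prog [n] (triangle n)"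
proof (induction n)
  case 0
  then show ?case unfolding triangle_prog_def
    by (auto intro!: rec_eval.PrimRec_0 rec_eval.Zero)
next
  case (Suc n)
  have "rec_eval (Comp add_prog [Proj 0, Proj 1]) [n, triangle n] (n + triangle n)"
    by (rule rec_eval_Comp2[OF _ _ add_prog]) (auto intro!: rec_eval_Proj_eq)
  then have "rec_eval (Comp Succ [Comp add_prog [Proj 0, Proj 1]]) [n, triangle n] (triangle (Suc n))"
    using rec_eval_Comp1[OF _ rec_eval.Succ] by (fastforce simp: add.commute)
  then show ?case using Suc unfolding triangle_prog_def
    by (auto intro!: rec_eval.PrimRec_Suc)
qed

lemma pair_prog: "rec_eval pair_prog [x, y] (prod_encode (x, y))"
  unfolding pair_prog_def prod_encode_def
  by (auto intro!: rec_eval_Comp2[OF _ _ add_prog] rec_eval_Comp1[OF _ triangle_prog] add_prog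
      rec_eval_Proj_eq)

lemma triangle_mono: "m \<le> n \<Longrightarrow> triangle m \<le> triangle n"
  unfolding triangle_def by (intro div_le_mono mult_le_mono) auto

lemma root_prog: "rec_eval root_prog [prod_encode (x, y)] (x + y)"
  unfolding root_prog_def
proof (rule rec_eval.Mu)
  let ?z = "prod_encode (x, y)"
  let ?f = "Comp sub_prog [Comp triangle_prog [Comp Succ [Proj 0]], Comp Succ [Proj 1]]"
  have f: "rec_eval ?f [s, ?z] (Suc ?z - triangle (Suc s))" for s
    by (intro rec_eval_Comp2[OF _ _ sub_prog] rec_eval_Comp1[OF _ triangle_prog]
        rec_eval_Comp1[OF _ rec_eval.Succ] rec_eval_Proj_eq) auto
  have "Suc ?z - triangle (Suc (x + y)) = 0"
    by (simp add: prod_encode_def)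
  then show "rec_eval ?f [x + y, ?z] 0" using f[of "x + y"] by simp
  show "\<forall>m<x + y. \<exists>v>0. rec_eval ?f [m, ?z] v"
  proof (intro allI impI)
    fix m assume "m < x + y"
    then have "triangle (Suc m) \<le> triangle (x + y)" by (intro triangle_mono) simp
    then have "0 < Suc ?z - triangle (Suc m)" by (simp add: prod_encode_def)
    then show "\<exists>v>0. rec_eval ?f [m, ?z] v" using f by blast
  qed
qed

lemma fst_prog_encode: "rec_eval fst_prog [prod_encode (x, y)] x"
proof -
  have "prod_encode (x, y) - triangle (x + y) = x" by (simp add: prod_encode_def)
  then show ?thesis unfolding fst_prog_def
    using rec_eval_Comp2[OF rec_eval_Comp1[OF root_prog triangle_prog] rec_eval_Proj_eq sub_prog,
        of 0 x y "prod_encode (x, y)"]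
    by simp
qed

lemma snd_prog_encode: "rec_eval snd_prog [prod_encode (x, y)] y"
  using rec_eval_Comp2[OF fst_prog_encode root_prog sub_prog, of x y] unfolding snd_prog_def
  by simp

lemma fst_prog: "rec_eval fst_prog [z] (pfst z)"
  and snd_prog: "rec_eval snd_prog [z] (psnd z)"
  using fst_prog_encode[of "pfst z" "psnd z"] snd_prog_encode[of "pfst z" "psnd z"] by simp_all

text \<open>
  All computability is expressed by total unary functions; several arguments are packed into one
  number with \<^const>\<open>prod_encode\<close>.
\<close>

definition recursive :: "(nat \<Rightarrow> nat) \<Rightarrow> bool" where
  "recursive f \<longleftrightarrow> (\<exists>r. \<forall>x. rec_eval r [x] (f x))"

definition decidable :: "(nat \<Rightarrow> bool) \<Rightarrow> bool" where
  "decidable P \<longleftrightarrow> recursive (\<lambda>x. of_bool (P x))"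

section \<open>Closure rules for recursive functions and decidable predicates\<close>

named_theorems rec_intros

lemma recursive_id [rec_intros]: "recursive (\<lambda>e. e)"
  unfolding recursive_def by (rule exI[of _ "Proj 0"]) (auto intro!: rec_eval_Proj_eq)

lemma recursive_const [rec_intros]: "recursive (\<lambda>e. c)"
proof (induction c)
  case 0
  then show ?case unfolding recursive_def by (intro exI[of _ Zero] allI rec_eval.Zero)
next
  case (Suc c)
  then obtain r where "\<And>x. rec_eval r [x] c" unfolding recursive_def by auto
  then have "\<forall>x. rec_eval (Comp Succ [r]) [x] (Suc c)" by (auto intro: rec_eval_Comp1 rec_eval.Succ)
  then show ?case unfolding recursive_def by (rule exI)
qed

lemma recursive_comp:
  assumes "recursive f" "recursive g" shows "recursive (\<lambda>e. f (g e))"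
proof -
  obtain rf rg where "\<And>x. rec_eval rf [x] (f x)" "\<And>x. rec_eval rg [x] (g x)"
    using assms unfolding recursive_def by auto
  then have "\<forall>x. rec_eval (Comp rf [rg]) [x] (f (g x))" by (intro allI rec_eval_Comp1)
  then show ?thesis unfolding recursive_def by (rule exI)
qed

lemma recursive_prog2:
  assumes "\<And>x y. rec_eval r [x, y] (f x y)" "recursive g" "recursive h"
  shows "recursive (\<lambda>e. f (g e) (h e))"
proof -
  obtain rg rh where "\<And>x. rec_eval rg [x] (g x)" "\<And>x. rec_eval rh [x] (h x)"
    using assms(2,3) unfolding recursive_def by auto
  with assms(1) have "\<forall>x. rec_eval (Comp r [rg, rh]) [x] (f (g x) (h x))"
    by (intro allI rec_eval_Comp2)
  then show ?thesis unfolding recursive_def by (rule exI)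
qed

lemmas recursive_pair [rec_intros] = recursive_prog2[OF pair_prog]
lemmas recursive_add [rec_intros] = recursive_prog2[OF add_prog]
lemmas recursive_sub [rec_intros] = recursive_prog2[OF sub_prog]

lemma recursive_pfst [rec_intros]: "recursive f \<Longrightarrow> recursive (\<lambda>e. pfst (f e))"
  by (erule recursive_comp[rotated]) (use fst_prog in \<open>auto simp: recursive_def\<close>)

lemma recursive_psnd [rec_intros]: "recursive f \<Longrightarrow> recursive (\<lambda>e. psnd (f e))"
  by (erule recursive_comp[rotated]) (use snd_prog in \<open>auto simp: recursive_def\<close>)

lemma recursive_Suc [rec_intros]: "recursive f \<Longrightarrow> recursive (\<lambda>e. Suc (f e))"
  using recursive_add[OF recursive_const[of 1]] by simp

lemma recursive_comp2:
  assumes "recursive (\<lambda>z. f (pfst z) (psnd z))" "recursive g" "recursive h"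
  shows "recursive (\<lambda>e. f (g e) (h e))"
  using recursive_comp[OF assms(1) recursive_pair[OF assms(2,3)]] by simp

text \<open>The whole input \<open>e\<close> is carried along as the parameter of the recursion, so
  that start value, step and number of steps may all depend on it.\<close>

lemma recursive_rec_nat:
  assumes "recursive g" and h: "recursive (\<lambda>z. h (pfst z) (pfst (psnd z)) (psnd (psnd z)))"
    and "recursive k"
  shows "recursive (\<lambda>e. rec_nat (g e) (\<lambda>n u. h n u e) (k e))"
proof -
  obtain rg rh where rg: "\<And>x. rec_eval rg [x] (g x)"
    and rh: "\<And>z. rec_eval rh [z] (h (pfst z) (pfst (psnd z)) (psnd (psnd z)))"
    using assms unfolding recursive_def by auto
  define rh' where "rh' = Comp rh [Comp pair_prog [Proj 0, Comp pair_prog [Proj 1, Proj 2]]]"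
  have rh': "rec_eval rh' [n, u, e] (h n u e)" for n u e
  proof -
    have "rec_eval (Comp pair_prog [Proj 0, Comp pair_prog [Proj 1, Proj 2]]) [n, u, e]
        (prod_encode (n, prod_encode (u, e)))"
      by (intro rec_eval_Comp2[OF _ _ pair_prog] rec_eval_Proj_eq) auto
    from rec_eval_Comp1[OF this rh] show ?thesis by (simp add: rh'_def)
  qed
  have "rec_eval (PrimRec rg rh') [n, e] (rec_nat (g e) (\<lambda>n u. h n u e) n)" for n e
    by (induction n) (auto intro!: rec_eval.PrimRec_0 rg rec_eval.PrimRec_Suc rh')
  from recursive_prog2[OF this assms(3) recursive_id] show ?thesis .
qed

text \<open>\<open>Mu\<close> looks for a zero, hence the search runs on
  \<open>1 - of_bool (P n e)\<close>; \<open>ex\<close> makes it stop on every input.\<close>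

lemma recursive_Least:
  assumes P: "decidable (\<lambda>z. P (pfst z) (psnd z))" and ex: "\<And>e. \<exists>n. P n e"
  shows "recursive (\<lambda>e. LEAST n. P n e)"
proof -
  have "recursive (\<lambda>z. 1 - of_bool (P (pfst z) (psnd z)))"
    using P unfolding decidable_def by (intro recursive_sub recursive_const)
  then obtain r where r: "\<And>z. rec_eval r [z] (1 - of_bool (P (pfst z) (psnd z)))"
    unfolding recursive_def by auto
  define r' where "r' = Comp r [Comp pair_prog [Proj 0, Proj 1]]"
  have r': "rec_eval r' [n, e] (1 - of_bool (P n e))" for n e
  proof -
    have "rec_eval (Comp pair_prog [Proj 0, Proj 1]) [n, e] (prod_encode (n, e))"
      by (intro rec_eval_Comp2[OF _ _ pair_prog] rec_eval_Proj_eq) auto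
    from rec_eval_Comp1[OF this r] show ?thesis by (simp add: r'_def)
  qed
  have "rec_eval (Mu r') [e] (LEAST n. P n e)" for e
  proof (rule rec_eval.Mu)
    show "rec_eval r' [LEAST n. P n e, e] 0"
      using r'[of "LEAST n. P n e" e] LeastI_ex[OF ex[of e]] by simp
    show "\<forall>m<LEAST n. P n e. \<exists>v>0. rec_eval r' [m, e] v"
    proof (intro allI impI exI conjI)
      fix m assume "m < (LEAST n. P n e)"
      then show "rec_eval r' [m, e] 1" using r'[of m e] not_less_Least by fastforce
    qed simp
  qed
  then show ?thesis unfolding recursive_def by (intro exI allI)
qed

lemma recursive_mult [rec_intros]:
  assumes "recursive f" "recursive g" shows "recursive (\<lambda>e. f e * g e)"
proof -
  have "recursive (\<lambda>e. rec_nat 0 (\<lambda>n u. u + g e) (f e))"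
    by (intro recursive_rec_nat rec_intros assms recursive_comp[OF assms(2)])
  moreover have "rec_nat 0 (\<lambda>n u. u + b) a = a * b" for a b :: nat by (induction a) auto
  ultimately show ?thesis by simp
qed

lemma recursive_fact [rec_intros]:
  assumes "recursive f" shows "recursive (\<lambda>e. fact (f e))"
proof -
  have "recursive (\<lambda>e. rec_nat 1 (\<lambda>n u. Suc n * u) (f e))"
    by (intro recursive_rec_nat rec_intros assms)
  moreover have "rec_nat 1 (\<lambda>n u. Suc n * u) a = fact a" for a :: nat by (induction a) auto
  ultimately show ?thesis by simp
qed

lemma recursive_sum [rec_intros]:
  assumes "recursive b" "recursive (\<lambda>z. f (pfst z) (psnd z))"
  shows "recursive (\<lambda>e. \<Sum>i<b e. f i e)"
proof -
  have "recursive (\<lambda>e. rec_nat 0 (\<lambda>n u. u + f n e) (b e))"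
    by (intro recursive_rec_nat rec_intros assms recursive_comp2[OF assms(2)])
  moreover have "rec_nat 0 (\<lambda>n u. u + h n) a = (\<Sum>i<a. h i)" for a and h :: "nat \<Rightarrow> nat"
    by (induction a) auto
  ultimately show ?thesis by simp
qed

lemma recursive_of_bool [rec_intros]: "decidable P \<Longrightarrow> recursive (\<lambda>e. of_bool (P e))"
  by (simp add: decidable_def)

lemma decidable_comp: "decidable P \<Longrightarrow> recursive g \<Longrightarrow> decidable (\<lambda>e. P (g e))"
  unfolding decidable_def by (rule recursive_comp)

lemma decidable_comp2:
  "decidable (\<lambda>z. P (pfst z) (psnd z)) \<Longrightarrow> recursive g \<Longrightarrow> recursive h \<Longrightarrow> decidable (\<lambda>e. P (g e) (h e))"
  unfolding decidable_def by (rule recursive_comp2)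

lemma decidable_not [rec_intros]:
  assumes "decidable P" shows "decidable (\<lambda>e. \<not> P e)"
proof -
  have "recursive (\<lambda>e. 1 - of_bool (P e))" by (intro rec_intros assms)
  moreover have "1 - of_bool p = (of_bool (\<not> p) :: nat)" for p by simp
  ultimately show ?thesis unfolding decidable_def by simp
qed

lemma decidable_conj [rec_intros]: "decidable P \<Longrightarrow> decidable Q \<Longrightarrow> decidable (\<lambda>e. P e \<and> Q e)"
  unfolding decidable_def of_bool_conj by (rule recursive_mult)

lemma decidable_disj [rec_intros]:
  assumes "decidable P" "decidable Q" shows "decidable (\<lambda>e. P e \<or> Q e)"
proof -
  have "decidable (\<lambda>e. \<not> (\<not> P e \<and> \<not> Q e))" by (intro rec_intros assms)
  then show ?thesis by simp
qed

lemma decidable_less [rec_intros]: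
  assumes "recursive f" "recursive g" shows "decidable (\<lambda>e. f e < g e)"
proof -
  have "recursive (\<lambda>e. 1 - (1 - (g e - f e)))" by (intro rec_intros assms)
  moreover have "1 - (1 - (b - a)) = of_bool (a < b)" for a b :: nat by auto
  ultimately show ?thesis unfolding decidable_def by simp
qed

lemma decidable_le [rec_intros]:
  assumes "recursive f" "recursive g" shows "decidable (\<lambda>e. f e \<le> g e)"
  using decidable_not[OF decidable_less[OF assms(2,1)]] by (simp add: not_less)

lemma decidable_eq [rec_intros]:
  assumes "recursive f" "recursive g" shows "decidable (\<lambda>e. f e = g e)"
proof -
  have "decidable (\<lambda>e. f e \<le> g e \<and> g e \<le> f e)" by (intro rec_intros assms)
  moreover have "(\<lambda>e. f e = g e) = (\<lambda>e. f e \<le> g e \<and> g e \<le> f e)" by (rule ext) (rule order_eq_iff)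
  ultimately show ?thesis by (simp only:)
qed

lemma recursive_if [rec_intros]:
  assumes "decidable P" "recursive f" "recursive g"
  shows "recursive (\<lambda>e. if P e then f e else g e)"
proof -
  have "recursive (\<lambda>e. of_bool (P e) * f e + of_bool (\<not> P e) * g e)" by (intro rec_intros assms)
  moreover have "of_bool p * a + of_bool (\<not> p) * b = (if p then a else b)" for p and a b :: nat
    by simp
  ultimately show ?thesis by simp
qed

lemma decidable_ex_less [rec_intros]:
  assumes "recursive b" "decidable (\<lambda>z. P (pfst z) (psnd z))"
  shows "decidable (\<lambda>e. \<exists>i<b e. P i e)"
proof -
  have "decidable (\<lambda>e. 0 < (\<Sum>i<b e. of_bool (P i e) :: nat))"
    by (intro rec_intros assms)
  moreover have "0 < (\<Sum>i<a. of_bool (Q i) :: nat) \<longleftrightarrow> (\<exists>i<a. Q i)" for a and Q :: "nat \<Rightarrow> bool"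
    by (induction a) (auto simp: less_Suc_eq)
  ultimately show ?thesis by simp
qed

lemma decidable_all_less [rec_intros]:
  assumes "recursive b" "decidable (\<lambda>z. P (pfst z) (psnd z))"
  shows "decidable (\<lambda>e. \<forall>i<b e. P i e)"
proof -
  have "decidable (\<lambda>e. \<not> (\<exists>i<b e. \<not> P i e))" by (intro rec_intros assms)
  then show ?thesis by simp
qed

section \<open>A universal predicate\<close>

definition cons_code :: "nat \<Rightarrow> nat \<Rightarrow> nat" where "cons_code x L = Suc (prod_encode (x, L))"
text \<open>A nonempty list has a code of the form \<open>Suc (prod_encode (x, L))\<close>, the
  empty list has code 0. By truncated subtraction the latter gets head 0 and tail 0, the default
  behind \<open>drop_code\<close> and \<open>nth_code\<close> past the end of a list.\<close>

definition hd_code :: "nat \<Rightarrow> nat" where "hd_code L = pfst (L - 1)"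
definition tl_code :: "nat \<Rightarrow> nat" where "tl_code L = psnd (L - 1)"
definition drop_code :: "nat \<Rightarrow> nat \<Rightarrow> nat" where "drop_code i L = rec_nat L (\<lambda>_. tl_code) i"
definition nth_code :: "nat \<Rightarrow> nat \<Rightarrow> nat" where "nth_code L i = hd_code (drop_code i L)"
definition len_code :: "nat \<Rightarrow> nat" where "len_code L = (LEAST i. drop_code i L = 0)"

lemma recursive_cons_code [rec_intros]:
  "recursive f \<Longrightarrow> recursive g \<Longrightarrow> recursive (\<lambda>e. cons_code (f e) (g e))"
  unfolding cons_code_def by (intro rec_intros)

lemma recursive_hd_code [rec_intros]: "recursive f \<Longrightarrow> recursive (\<lambda>e. hd_code (f e))"
  unfolding hd_code_def by (intro rec_intros)

lemma recursive_tl_code [rec_intros]: "recursive f \<Longrightarrow> recursive (\<lambda>e. tl_code (f e))"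
  unfolding tl_code_def by (intro rec_intros)

lemma recursive_drop_code [rec_intros]:
  "recursive f \<Longrightarrow> recursive g \<Longrightarrow> recursive (\<lambda>e. drop_code (f e) (g e))"
  unfolding drop_code_def by (intro recursive_rec_nat rec_intros)

lemma recursive_nth_code [rec_intros]:
  "recursive f \<Longrightarrow> recursive g \<Longrightarrow> recursive (\<lambda>e. nth_code (f e) (g e))"
  unfolding nth_code_def by (intro rec_intros)

lemma cons_code: "cons_code x (list_encode xs) = list_encode (x # xs)"
  by (simp add: cons_code_def)

lemma prod_decode_0 [simp]: "prod_decode 0 = (0, 0)"
proof -
  have "prod_encode (0, 0) = 0" by (simp add: prod_encode_def)
  then show ?thesis by (metis prod_encode_inverse)
qed

lemma hd_code_list_encode: "hd_code (list_encode xs) = (case xs of [] \<Rightarrow> 0 | x # _ \<Rightarrow> x)"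
  by (simp add: hd_code_def split: list.splits)

lemma tl_code_list_encode [simp]: "tl_code (list_encode xs) = list_encode (tl xs)"
  by (cases xs) (simp_all add: tl_code_def)

lemma drop_code_list_encode [simp]: "drop_code i (list_encode xs) = list_encode (drop i xs)"
proof (induction i)
  case (Suc i)
  have "drop_code (Suc i) (list_encode xs) = tl_code (drop_code i (list_encode xs))"
    by (simp add: drop_code_def)
  then show ?case using Suc by (simp add: drop_Suc tl_drop)
qed (simp add: drop_code_def)

lemma nth_code_list_encode: "nth_code (list_encode xs) i = (if i < length xs then xs ! i else 0)"
  by (auto simp: nth_code_def hd_code_list_encode hd_drop_conv_nth[symmetric] split: list.splits)

lemma list_encode_eq_0_iff: "list_encode xs = 0 \<longleftrightarrow> xs = []"
  by (cases xs) simp_all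

lemma len_code_list_encode [simp]: "len_code (list_encode xs) = length xs"
  by (auto simp: len_code_def list_encode_eq_0_iff intro!: Least_equality)

text \<open>Lets the code of a word serve as a bound on its length when words are evaluated.\<close>

lemma length_le_list_encode: "length xs \<le> list_encode xs"
proof (induction xs)
  case (Cons x xs)
  then show ?case using le_prod_encode_2[of "list_encode xs" x] by simp
qed simp

lemma recursive_len_code [rec_intros]:
  assumes "recursive f" shows "recursive (\<lambda>e. len_code (f e))"
proof (rule recursive_comp[OF _ assms])
  show "recursive len_code" unfolding len_code_def
  proof (rule recursive_Least)
    show "decidable (\<lambda>z. drop_code (pfst z) (psnd z) = 0)" by (intro rec_intros)
    show "\<exists>i. drop_code i L = 0" for L
      using drop_code_list_encode[of "length (list_decode L)" "list_decode L"] by auto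
  qed
qed

lemma elem_less_list_encode: "x \<in> set xs \<Longrightarrow> x < list_encode xs"
proof (induction xs)
  case (Cons y ys)
  then show ?case
    using le_prod_encode_1[of y "list_encode ys"] le_prod_encode_2[of "list_encode ys" y] by auto
qed simp

lemma decidable_mem [rec_intros]:
  assumes "recursive f" "recursive g"
  shows "decidable (\<lambda>e. f e \<in> set (list_decode (g e)))"
proof -
  have "decidable (\<lambda>e. \<exists>i<len_code (g e). f e = nth_code (g e) i)"
    by (intro rec_intros assms recursive_comp[OF assms(1)] recursive_comp[OF assms(2)])
  moreover have "x \<in> set xs \<longleftrightarrow> (\<exists>i<len_code (list_encode xs). x = nth_code (list_encode xs) i)" for x xs
    by (auto simp: in_set_conv_nth nth_code_list_encode)
  from this[of _ "list_decode L" for L] have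
    "x \<in> set (list_decode L) \<longleftrightarrow> (\<exists>i<len_code L. x = nth_code L i)" for x L by simp
  ultimately show ?thesis by simp
qed

section \<open>Programs as numbers, and derivations of halting facts\<close>

primrec prog_code :: "recf \<Rightarrow> nat" where
  "prog_code Zero = prod_encode (0, 0)"
| "prog_code Succ = prod_encode (1, 0)"
| "prog_code (Proj i) = prod_encode (2, i)"
| "prog_code (Comp f gs) = prod_encode (3, prod_encode (prog_code f, list_encode (map prog_code gs)))"
| "prog_code (PrimRec f g) = prod_encode (4, prod_encode (prog_code f, prog_code g))"
| "prog_code (Mu f) = prod_encode (5, prog_code f)"

text \<open>Stands for the claim that the program coded by \<open>e\<close> yields \<open>y\<close>
  on the argument list coded by \<open>xs\<close>.\<close>

definition fact_code :: "nat \<Rightarrow> nat \<Rightarrow> nat \<Rightarrow> nat" where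
  "fact_code e xs y = prod_encode (e, prod_encode (xs, y))"

text \<open>
  The disjuncts are the rules of \<^const>\<open>rec_eval\<close>, read on codes: \<open>e\<close> is the program, \<open>xs\<close> the argument
  list, \<open>y\<close> the result and \<open>S\<close> the set of facts available as premises.
\<close>

definition justified :: "nat set \<Rightarrow> nat \<Rightarrow> nat \<Rightarrow> nat \<Rightarrow> bool" where
  "justified S e xs y \<longleftrightarrow>
    pfst e = 0 \<and> y = 0
  \<or> pfst e = 1 \<and> 0 < y \<and> xs = cons_code (y - 1) 0
  \<or> pfst e = 2 \<and> psnd e < len_code xs \<and> y = nth_code xs (psnd e)
  \<or> pfst e = 3 \<and> (\<exists>ys. fact_code (pfst (psnd e)) ys y \<in> S \<and> len_code ys = len_code (psnd (psnd e))
      \<and> (\<forall>i<len_code ys. fact_code (nth_code (psnd (psnd e)) i) xs (nth_code ys i) \<in> S))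
  \<or> pfst e = 4 \<and> 0 < len_code xs \<and> hd_code xs = 0 \<and> fact_code (pfst (psnd e)) (tl_code xs) y \<in> S
  \<or> pfst e = 4 \<and> 0 < len_code xs \<and> 0 < hd_code xs
      \<and> (\<exists>u. fact_code e (cons_code (hd_code xs - 1) (tl_code xs)) u \<in> S
           \<and> fact_code (psnd (psnd e)) (cons_code (hd_code xs - 1) (cons_code u (tl_code xs))) y \<in> S)
  \<or> pfst e = 5 \<and> fact_code (psnd e) (cons_code y xs) 0 \<in> S
      \<and> (\<forall>m<y. \<exists>v. 0 < v \<and> fact_code (psnd e) (cons_code m xs) v \<in> S)"

text \<open>The set of facts occurs only positively, as a supply of premises.\<close>

lemma justified_mono:
  assumes "justified S e xs y" "S \<subseteq> S'" shows "justified S' e xs y"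
  using assms(1) unfolding justified_def
  by (elim disjE) (simp_all, (use assms(2) in \<open>meson subsetD\<close>)+)

text \<open>Read from the end of the list: each fact is justified by the facts behind it.\<close>

fun derivation :: "nat list \<Rightarrow> bool" where
  "derivation [] \<longleftrightarrow> True"
| "derivation (p # ps) \<longleftrightarrow>
    justified (set ps) (pfst p) (pfst (psnd p)) (psnd (psnd p)) \<and> derivation ps"

lemma derivation_append: "derivation ps \<Longrightarrow> derivation qs \<Longrightarrow> derivation (ps @ qs)"
  by (induction ps) (auto elim: justified_mono)

definition derivable :: "nat \<Rightarrow> bool" where
  "derivable p \<longleftrightarrow> (\<exists>ps. derivation ps \<and> p \<in> set ps)"

text \<open>The rules for \<open>Comp\<close> and \<open>Mu\<close> have any finite number of
  premises, which must occur in one derivation; concatenation provides it.\<close>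

lemma derivable_finite:
  assumes "finite F" "\<And>p. p \<in> F \<Longrightarrow> derivable p"
  shows "\<exists>ps. derivation ps \<and> F \<subseteq> set ps"
  using assms
proof (induction F rule: finite_induct)
  case empty
  then show ?case by (intro exI[of _ "[]"]) simp
next
  case (insert p F)
  then obtain ps where "derivation ps" "F \<subseteq> set ps" by auto
  moreover obtain qs where "derivation qs" "p \<in> set qs" using insert.prems derivable_def by auto
  ultimately show ?case using derivation_append by (intro exI[of _ "ps @ qs"]) auto
qed

lemma derivableI:
  assumes "finite F" "\<And>p. p \<in> F \<Longrightarrow> derivable p" "justified F e xs y"
  shows "derivable (fact_code e xs y)"
proof -
  obtain ps where ps: "derivation ps" "F \<subseteq> set ps" using derivable_finite[OF assms(1,2)] by blast
  then have "derivation (fact_code e xs y # ps)"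
    using justified_mono[OF assms(3)] by (simp add: fact_code_def)
  then show ?thesis unfolding derivable_def by (intro exI[of _ "fact_code e xs y # ps"]) simp
qed

abbreviation eval_fact :: "recf \<Rightarrow> nat list \<Rightarrow> nat \<Rightarrow> nat" where
  "eval_fact r xs y \<equiv> fact_code (prog_code r) (list_encode xs) y"

lemma derivable_if_rec_eval: "rec_eval r xs y \<Longrightarrow> derivable (eval_fact r xs y)"
proof (induction rule: rec_eval.induct)
  case (Zero xs)
  then show ?case by (intro derivableI[of "{}"]) (simp_all add: justified_def)
next
  case (Succ x)
  then show ?case by (intro derivableI[of "{}"]) (simp_all add: justified_def cons_code_def)
next
  case (Proj i xs)
  then show ?case
    by (intro derivableI[of "{}"]) (simp_all add: justified_def nth_code_list_encode)
next
  case (Comp xs gs ys f z)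
  let ?F = "insert (eval_fact f ys z) ((\<lambda>i. eval_fact (gs ! i) xs (ys ! i)) ` {..<length ys})"
  have len: "length gs = length ys"
    and gs: "\<And>i. i < length ys \<Longrightarrow> derivable (eval_fact (gs ! i) xs (ys ! i))"
    using Comp.IH(1) by (auto simp: list_all2_conv_all_nth)
  show ?case
  proof (rule derivableI[of ?F])
    show "derivable p" if "p \<in> ?F" for p using that gs Comp.IH by auto
    show "justified ?F (prog_code (Comp f gs)) (list_encode xs) z"
      unfolding justified_def using len
      by (auto simp: nth_code_list_encode intro!: exI[of _ "list_encode ys"])
  qed simp
next
  case (PrimRec_0 f xs y g)
  then show ?case
    by (intro derivableI[of "{eval_fact f xs y}"])
      (simp_all add: justified_def hd_code_list_encode del: list_encode.simps)
next
  case (PrimRec_Suc f g n xs u y)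
  let ?F = "{eval_fact (PrimRec f g) (n # xs) u, eval_fact g (n # u # xs) y}"
  show ?case
  proof (rule derivableI[of ?F])
    show "derivable p" if "p \<in> ?F" for p using that PrimRec_Suc.IH by auto
    show "justified ?F (prog_code (PrimRec f g)) (list_encode (Suc n # xs)) y"
      unfolding justified_def
      by (auto simp: hd_code_list_encode cons_code simp del: list_encode.simps)
  qed simp
next
  case (Mu f n xs)
  from Mu.IH(2) obtain v where v: "\<And>m. m < n \<Longrightarrow> 0 < v m \<and> derivable (eval_fact f (m # xs) (v m))"
    by metis
  let ?F = "insert (eval_fact f (n # xs) 0) ((\<lambda>m. eval_fact f (m # xs) (v m)) ` {..<n})"
  show ?case
  proof (rule derivableI[of ?F])
    show "derivable p" if "p \<in> ?F" for p using that Mu.IH v by auto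
    have "\<forall>m<n. \<exists>w. 0 < w \<and> eval_fact f (m # xs) w \<in> ?F"
      using v by (intro allI impI, rule_tac x = "v m" in exI) blast
    then show "justified ?F (prog_code (Mu f)) (list_encode xs) n"
      unfolding justified_def by (simp add: cons_code del: list_encode.simps)
  qed simp
qed

text \<open>Soundness of a single inference. A fact about \<open>r\<close> can only be justified by
  facts about \<open>r\<close> and its constituents, so facts in \<open>S\<close> about numbers that
  code no program do no harm.\<close>

lemma rec_eval_if_justified:
  assumes "justified S (prog_code r) (list_encode xs) y"
    and S: "\<And>r' xs' y'. eval_fact r' xs' y' \<in> S \<Longrightarrow> rec_eval r' xs' y'"
  shows "rec_eval r xs y"
proof (cases r)
  case Zero
  then show ?thesis using assms(1) by (auto simp: justified_def intro: rec_eval.Zero)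
next
  case Succ
  then obtain n where "y = Suc n" "list_encode xs = list_encode [n]"
    using assms(1) by (cases y) (auto simp: justified_def cons_code_def)
  then have "xs = [n]" by (simp only: list_encode_eq)
  then show ?thesis using Succ \<open>y = Suc n\<close> by (auto intro: rec_eval.Succ)
next
  case (Proj i)
  then show ?thesis using assms(1)
    by (auto simp: justified_def nth_code_list_encode intro: rec_eval.Proj)
next
  case (Comp f gs)
  then obtain ys where ys: "fact_code (prog_code f) ys y \<in> S" "len_code ys = length gs"
    "\<And>i. i < len_code ys \<Longrightarrow> fact_code (nth_code (list_encode (map prog_code gs)) i) (list_encode xs)
      (nth_code ys i) \<in> S"
    using assms(1) by (auto simp: justified_def)
  \<comment> \<open>Every number codes a list, so the intermediate values can be decoded.\<close>
  define zs where "zs = list_decode ys"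
  have ys_eq: "ys = list_encode zs" by (simp add: zs_def)
  have "list_all2 (\<lambda>g y. rec_eval g xs y) gs zs"
    unfolding list_all2_conv_all_nth
  proof (intro conjI allI impI)
    show "length gs = length zs" using ys ys_eq by simp
    fix i assume "i < length gs"
    then show "rec_eval (gs ! i) xs (zs ! i)"
      using ys(2) ys(3)[of i] by (intro S) (simp add: ys_eq nth_code_list_encode)
  qed
  moreover have "rec_eval f zs y" using S ys(1) ys_eq by simp
  ultimately show ?thesis using Comp by (auto intro: rec_eval.Comp)
next
  case (PrimRec f g)
  then obtain n xs' where xs: "xs = n # xs'"
    using assms(1) by (cases xs) (auto simp: justified_def simp del: list_encode.simps)
  show ?thesis
  proof (cases n)
    case 0
    then have "rec_eval f xs' y"
      using PrimRec assms(1) xs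
      by (intro S) (auto simp: justified_def hd_code_list_encode simp del: list_encode.simps)
    then show ?thesis using PrimRec xs 0 by (auto intro: rec_eval.PrimRec_0)
  next
    case (Suc m)
    then obtain u where "eval_fact r (m # xs') u \<in> S" "eval_fact g (m # u # xs') y \<in> S"
      using PrimRec assms(1) xs
      by (auto simp: justified_def hd_code_list_encode cons_code simp del: list_encode.simps)
    then have "rec_eval r (m # xs') u" "rec_eval g (m # u # xs') y" by (auto intro!: S)
    then show ?thesis using PrimRec xs Suc by (auto intro: rec_eval.PrimRec_Suc)
  qed
next
  case (Mu f)
  then have "eval_fact f (y # xs) 0 \<in> S" "\<forall>m<y. \<exists>v. 0 < v \<and> eval_fact f (m # xs) v \<in> S"
    using assms(1) by (auto simp: justified_def cons_code simp del: list_encode.simps)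
  then have "rec_eval f (y # xs) 0" "\<forall>m<y. \<exists>v>0. rec_eval f (m # xs) v" by (blast intro: S)+
  then show ?thesis using Mu by (auto intro!: rec_eval.Mu)
qed

lemma rec_eval_if_derivation:
  "derivation ps \<Longrightarrow> eval_fact r xs y \<in> set ps \<Longrightarrow> rec_eval r xs y"
proof (induction ps arbitrary: r xs y)
  case (Cons p ps)
  show ?case
  proof (cases "eval_fact r xs y \<in> set ps")
    case True
    then show ?thesis using Cons by simp
  next
    case False
    then have "p = eval_fact r xs y" using Cons.prems by simp
    then have "justified (set ps) (prog_code r) (list_encode xs) y"
      using Cons.prems by (simp add: fact_code_def)
    then show ?thesis by (rule rec_eval_if_justified) (use Cons in auto)
  qed
qed simp

text \<open>Soundness and completeness combine to Kleene's normal form: halting is the existence of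
  a derivation, and being a derivation is shown decidable below.\<close>

lemma rec_eval_iff_derivation:
  "rec_eval r xs y \<longleftrightarrow> (\<exists>ps. derivation ps \<and> eval_fact r xs y \<in> set ps)"
  using derivable_if_rec_eval rec_eval_if_derivation unfolding derivable_def by blast

section \<open>Decidability of being a derivation\<close>

lemma recursive_fact_code [rec_intros]:
  "recursive f \<Longrightarrow> recursive g \<Longrightarrow> recursive h \<Longrightarrow> recursive (\<lambda>e. fact_code (f e) (g e) (h e))"
  unfolding fact_code_def by (intro rec_intros)

lemma fact_code_bounds:
  assumes "fact_code e xs y \<in> set (list_decode T)" shows "xs < T" "y < T"
proof -
  have "fact_code e xs y < T" using elem_less_list_encode[OF assms] by simp
  then show "xs < T" "y < T"
    using le_prod_encode_1[of xs y] le_prod_encode_2[of y xs] le_prod_encode_2[of "prod_encode (xs, y)" e]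
    unfolding fact_code_def by linarith+
qed

text \<open>The witnesses in \<^const>\<open>justified\<close> occur in the list, so they are bounded by its code.\<close>

lemma justified_bounded:
  "justified (set (list_decode T)) e xs y \<longleftrightarrow>
    pfst e = 0 \<and> y = 0
  \<or> pfst e = 1 \<and> 0 < y \<and> xs = cons_code (y - 1) 0
  \<or> pfst e = 2 \<and> psnd e < len_code xs \<and> y = nth_code xs (psnd e)
  \<or> pfst e = 3 \<and> (\<exists>ys<T. fact_code (pfst (psnd e)) ys y \<in> set (list_decode T) \<and> len_code ys = len_code (psnd (psnd e))
      \<and> (\<forall>i<len_code ys. fact_code (nth_code (psnd (psnd e)) i) xs (nth_code ys i) \<in> set (list_decode T)))
  \<or> pfst e = 4 \<and> 0 < len_code xs \<and> hd_code xs = 0 \<and> fact_code (pfst (psnd e)) (tl_code xs) y \<in> set (list_decode T)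
  \<or> pfst e = 4 \<and> 0 < len_code xs \<and> 0 < hd_code xs
      \<and> (\<exists>u<T. fact_code e (cons_code (hd_code xs - 1) (tl_code xs)) u \<in> set (list_decode T)
           \<and> fact_code (psnd (psnd e)) (cons_code (hd_code xs - 1) (cons_code u (tl_code xs))) y \<in> set (list_decode T))
  \<or> pfst e = 5 \<and> fact_code (psnd e) (cons_code y xs) 0 \<in> set (list_decode T)
      \<and> (\<forall>m<y. \<exists>v<T. 0 < v \<and> fact_code (psnd e) (cons_code m xs) v \<in> set (list_decode T))"
proof -
  have 1: "(\<exists>ys. fact_code a ys y \<in> set (list_decode T) \<and> P ys)
      \<longleftrightarrow> (\<exists>ys<T. fact_code a ys y \<in> set (list_decode T) \<and> P ys)" for a P
    using fact_code_bounds(1) by blast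
  have 2: "(\<exists>u. fact_code a b u \<in> set (list_decode T) \<and> P u)
      \<longleftrightarrow> (\<exists>u<T. fact_code a b u \<in> set (list_decode T) \<and> P u)" for a b P
    using fact_code_bounds(2) by blast
  have 3: "(\<exists>u. 0 < u \<and> fact_code a b u \<in> set (list_decode T))
      \<longleftrightarrow> (\<exists>u<T. 0 < u \<and> fact_code a b u \<in> set (list_decode T))" for a b
    using fact_code_bounds(2) by blast
  show ?thesis unfolding justified_def 1 2 3 ..
qed

lemma decidable_justified:
  "decidable (\<lambda>z. justified (set (list_decode (pfst z))) (pfst (psnd z)) (pfst (psnd (psnd z))) (psnd (psnd (psnd z))))"
  unfolding justified_bounded by (intro rec_intros)

text \<open>Trades the recursion over the list for a bounded quantifier over positions, which the
  closure rules can treat.\<close>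

lemma derivation_iff_nth:
  "derivation ps \<longleftrightarrow> (\<forall>i<length ps. justified (set (drop (Suc i) ps)) (pfst (ps ! i))
     (pfst (psnd (ps ! i))) (psnd (psnd (ps ! i))))"
proof (induction ps)
  case (Cons p ps)
  then show ?case by (auto simp: less_Suc_eq_0_disj)
qed simp

lemma decidable_derivation:
  "decidable (\<lambda>d. derivation (list_decode d))"
proof -
  let ?J = "\<lambda>T p. justified (set (list_decode T)) (pfst p) (pfst (psnd p)) (psnd (psnd p))"
  have J: "decidable (\<lambda>z. ?J (pfst z) (psnd z))"
    by (rule decidable_comp[OF decidable_justified, of "\<lambda>z. prod_encode (pfst z,
      prod_encode (pfst (psnd z), prod_encode (pfst (psnd (psnd z)), psnd (psnd (psnd z)))))", simplified])
      (intro rec_intros)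
  have "derivation (list_decode d) \<longleftrightarrow>
      (\<forall>i<len_code d. ?J (drop_code (Suc i) d) (nth_code d i))" for d
  proof -
    define ps where "ps = list_decode d"
    have d: "d = list_encode ps" by (simp add: ps_def)
    show ?thesis unfolding d by (simp add: derivation_iff_nth nth_code_list_encode)
  qed
  moreover have "decidable (\<lambda>d. \<forall>i<len_code d. ?J (drop_code (Suc i) d) (nth_code d i))"
    by (rule decidable_all_less) (intro rec_intros decidable_comp2[OF J])+
  ultimately show ?thesis by simp
qed

text \<open>The derivation code \<open>d\<close> plays the role of a halting time of the program
  \<open>n\<close> on input \<open>n\<close>; \<open>cons_code n 0\<close> is the code of the list
  \<open>[n]\<close>.\<close>

definition outputs :: "nat \<Rightarrow> nat \<Rightarrow> nat \<Rightarrow> bool" where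
  "outputs n b d \<longleftrightarrow> derivation (list_decode d) \<and> fact_code n (cons_code n 0) b \<in> set (list_decode d)"

lemma decidable_outputs [rec_intros]:
  "recursive f \<Longrightarrow> recursive g \<Longrightarrow> recursive h \<Longrightarrow> decidable (\<lambda>e. outputs (f e) (g e) (h e))"
  unfolding outputs_def by (intro rec_intros decidable_comp[OF decidable_derivation])

text \<open>The witness is the code of a program for \<open>f\<close>, run on itself; determinism
  excludes every output other than \<open>f n\<close>.\<close>

lemma outputs_universal:
  assumes "recursive f"
  shows "\<exists>n. \<forall>b. (\<exists>d. outputs n b d) \<longleftrightarrow> f n = b"
proof -
  obtain r where r: "\<And>x. rec_eval r [x] (f x)" using assms unfolding recursive_def by auto
  have "(\<exists>d. outputs (prog_code r) b d) \<longleftrightarrow> rec_eval r [prog_code r] b" for b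
    unfolding outputs_def rec_eval_iff_derivation
    by (simp add: cons_code_def) (metis list_encode_inverse)
  moreover have "rec_eval r [x] b \<longleftrightarrow> f x = b" for x b
    using r rec_eval_deterministic by blast
  ultimately show ?thesis by blast
qed

section \<open>Laurent polynomials and dominating weights\<close>

text \<open>The integral group ring of the infinite cyclic group generated by \<open>t\<close>, with
  convolution as product.\<close>

type_synonym laurent = "int \<Rightarrow>\<^sub>0 int"

abbreviation coef :: "('a \<Rightarrow>\<^sub>0 'b::zero) \<Rightarrow> 'a \<Rightarrow> 'b" where "coef \<equiv> Poly_Mapping.lookup"
abbreviation single :: "'a \<Rightarrow> 'b::zero \<Rightarrow> 'a \<Rightarrow>\<^sub>0 'b" where "single \<equiv> Poly_Mapping.single"
abbreviation tpow :: "int \<Rightarrow> laurent" where "tpow k \<equiv> single k 1"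

lemma laurent_eq_sum:
  fixes f :: laurent
  shows "f = (\<Sum>n\<in>Poly_Mapping.keys f. single n (coef f n))"
proof (rule poly_mapping_eqI)
  fix m
  show "coef f m = coef (\<Sum>n\<in>Poly_Mapping.keys f. single n (coef f n)) m"
    by (simp add: lookup_sum lookup_single when_def in_keys_iff)
qed

lemma tpow_add: "tpow (k + l) = tpow k * tpow l"
  by (simp add: mult_single)

lemma lookup_tpow_mult: "coef (tpow k * f) n = coef f (n - k)"
proof -
  have "tpow k * f = (\<Sum>m\<in>Poly_Mapping.keys f. single (k + m) (coef f m))"
    by (subst laurent_eq_sum[of f]) (simp add: sum_distrib_left mult_single)
  also have "coef \<dots> n = (\<Sum>m\<in>Poly_Mapping.keys f. if m = n - k then coef f m else 0)"
    unfolding lookup_sum by (rule sum.cong) (auto simp: lookup_single when_def)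
  also have "\<dots> = coef f (n - k)"
    by (simp add: in_keys_iff)
  finally show ?thesis .
qed

text \<open>The order compares coefficients at the least exponent where they differ, and a shift
  merely moves this exponent. This makes the ordering of the Hall group left-invariant.\<close>

lemma tpow_mult_less:
  assumes "f < g" shows "tpow k * f < tpow k * g"
proof -
  obtain n where n: "coef f n < coef g n"
      "\<And>m. m < n \<Longrightarrow> coef f m = coef g m"
    using assms unfolding less_poly_mapping.rep_eq less_fun_def by blast
  show ?thesis unfolding less_poly_mapping.rep_eq
    by (rule less_funI, rule exI[of _ "n + k"]) (simp add: lookup_tpow_mult n)
qed

text \<open>The additive map that sends each \<open>tpow n\<close> to
  \<open>\<gamma> n\<close>.\<close>

definition lin :: "(int \<Rightarrow> 'c::ring_1) \<Rightarrow> laurent \<Rightarrow> 'c" where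
  "lin \<gamma> f = (\<Sum>n\<in>Poly_Mapping.keys f. of_int (coef f n) * \<gamma> n)"

lemma lin_superset:
  assumes "finite A" "Poly_Mapping.keys f \<subseteq> A"
  shows "lin \<gamma> f = (\<Sum>n\<in>A. of_int (coef f n) * \<gamma> n)"
  unfolding lin_def using assms by (intro sum.mono_neutral_left) (auto simp: in_keys_iff)

lemma lin_add: "lin \<gamma> (f + g) = lin \<gamma> f + lin \<gamma> g"
proof -
  let ?A = "Poly_Mapping.keys f \<union> Poly_Mapping.keys g"
  have "Poly_Mapping.keys (f + g) \<subseteq> ?A" by (rule keys_add)
  then show ?thesis
    by (simp add: lin_superset[of ?A] lookup_add distrib_right sum.distrib)
qed

lemma lin_0 [simp]: "lin \<gamma> 0 = 0"
  by (simp add: lin_def)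

lemma lin_diff: "lin \<gamma> (f - g) = lin \<gamma> f - lin \<gamma> g"
  using lin_add[of \<gamma> "f - g" g] by simp

lemma lin_sum: "lin \<gamma> (\<Sum>i\<in>A. f i) = (\<Sum>i\<in>A. lin \<gamma> (f i))"
  by (induction A rule: infinite_finite_induct) (simp_all add: lin_add)

lemma lin_single [simp]: "lin \<gamma> (single n c) = of_int c * \<gamma> n"
  by (simp add: lin_def)

lemma keys_nonneg_finite: "finite {n. coef (f :: laurent) (int n + 1) \<noteq> 0}"
proof -
  have "finite ((\<lambda>n. int n + 1) -` Poly_Mapping.keys f)"
    by (rule finite_vimageI) (auto intro: injI)
  then show ?thesis by (simp add: vimage_def in_keys_iff)
qed

text \<open>Separates the exponent 0, which belongs to \<open>w\<close>, from the exponents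
  \<open>n + 1\<close>, which belong to the programs \<open>n\<close>.\<close>

lemma lin_supported_nonneg:
  assumes "\<And>v. v < 0 \<Longrightarrow> \<gamma> v = 0"
  shows "lin \<gamma> f = of_int (coef f 0) * \<gamma> 0
    + (\<Sum>n | coef f (int n + 1) \<noteq> 0. of_int (coef f (int n + 1)) * \<gamma> (int n + 1))"
proof -
  let ?h = "\<lambda>v. of_int (coef f v) * \<gamma> v" and ?I = "{n. coef f (int n + 1) \<noteq> 0}"
  have inj: "inj_on (\<lambda>n. int n + 1) ?I" by (auto intro: inj_onI)
  have "lin \<gamma> f = sum ?h (insert 0 ((\<lambda>n. int n + 1) ` ?I))"
    unfolding lin_def
  proof (rule sum.mono_neutral_cong)
    show "finite (insert 0 ((\<lambda>n. int n + 1) ` ?I))" using keys_nonneg_finite by simp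
    fix v assume v: "v \<in> Poly_Mapping.keys f - insert 0 ((\<lambda>n. int n + 1) ` ?I)"
    have "v < 0"
    proof (rule ccontr)
      assume "\<not> v < 0"
      with v have v_eq: "v = int (nat (v - 1)) + 1" by auto
      with v have "nat (v - 1) \<in> ?I" by (simp add: in_keys_iff)
      with v_eq have "v \<in> (\<lambda>n. int n + 1) ` ?I" by (rule image_eqI)
      with v show False by blast
    qed
    then show "?h v = 0" using assms by simp
  qed (auto simp: in_keys_iff)
  also have "\<dots> = ?h 0 + (\<Sum>n\<in>?I. ?h (int n + 1))"
    using keys_nonneg_finite by (subst sum.insert) (auto simp: sum.reindex[OF inj])
  finally show ?thesis by simp
qed

section \<open>Weights that grow like factorials\<close>

definition weight :: "nat \<Rightarrow> int" where "weight q = int (Suc q * fact (Suc q))"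

text \<open>The sum telescopes, since \<open>weight q\<close> equals
  \<open>fact (q + 2) - fact (q + 1)\<close>.\<close>

lemma sum_weight: "1 + (\<Sum>j<q. weight j) = fact (Suc q)"
  by (induction q) (simp_all add: weight_def algebra_simps)

text \<open>
  Since the weights below the largest index sum to less than a factorial, a term of index at least
  the coefficient bound cannot be cancelled.
\<close>

lemma weighted_sum_nonzero:
  fixes c s :: "'i \<Rightarrow> int"
  assumes "finite I" "inj_on q I" and c: "\<And>i. i \<in> I \<Longrightarrow> \<bar>c i\<bar> \<le> int B" and s: "\<And>i. i \<in> I \<Longrightarrow> \<bar>s i\<bar> = 1"
    and c0: "\<bar>c0\<bar> \<le> int B" and i0: "i0 \<in> I" "c i0 \<noteq> 0" "B \<le> q i0"
  shows "c0 + (\<Sum>i\<in>I. c i * (s i * weight (q i))) \<noteq> 0"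
proof -
  let ?t = "\<lambda>i. c i * (s i * weight (q i))"
  define J where "J = {i \<in> I. c i \<noteq> 0}"
  have J: "finite J" "i0 \<in> J" using assms by (auto simp: J_def)
  \<comment> \<open>Among the indices with nonzero coefficient, the one with the largest weight will
    outweigh all others and \<open>c0\<close> together.\<close>
  define mq where "mq = Max (q ` J)"
  have "mq \<in> q ` J" unfolding mq_def using J by (intro Max_in) auto
  then obtain m where m: "m \<in> J" "q m = mq" by auto
  have le: "q i \<le> mq" if "i \<in> J" for i unfolding mq_def using that J by simp
  have less: "q i < mq" if "i \<in> J - {m}" for i
  proof -
    have "q i \<noteq> q m" using that m assms(2) by (auto simp: J_def inj_on_def)
    then show ?thesis using le[of i] that m by auto
  qed
  have B: "B \<le> mq" using le[OF J(2)] i0 by simp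
  have w0: "0 \<le> weight j" for j by (simp add: weight_def)
  have abs_t: "\<bar>?t i\<bar> = \<bar>c i\<bar> * weight (q i)" if "i \<in> I" for i
    using s[OF that] w0 by (simp add: abs_mult)
  have "\<bar>\<Sum>i\<in>J-{m}. ?t i\<bar> \<le> (\<Sum>i\<in>J-{m}. \<bar>?t i\<bar>)" by (rule sum_abs)
  also have "\<dots> \<le> (\<Sum>i\<in>J-{m}. int B * weight (q i))"
    by (intro sum_mono) (auto simp: abs_t J_def intro!: mult_right_mono c w0)
  also have "\<dots> = int B * (\<Sum>j\<in>q ` (J-{m}). weight j)"
    using assms(2) by (subst sum.reindex) (auto simp: J_def sum_distrib_left intro: inj_on_subset)
  also have "\<dots> \<le> int B * (\<Sum>j<mq. weight j)"
    using less by (intro mult_left_mono sum_mono2) (auto intro: w0)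
  \<comment> \<open>The bound on \<open>c0\<close> supplies the summand 1 of the telescoping
    sum.\<close>
  finally have "\<bar>c0 + (\<Sum>i\<in>J-{m}. ?t i)\<bar> \<le> int B * (1 + (\<Sum>j<mq. weight j))"
    using c0 by (simp add: algebra_simps)
  also have "\<dots> = int B * fact (Suc mq)" by (simp only: sum_weight)
  \<comment> \<open>Strict because \<open>B \<le> q i0 \<le> mq\<close>, hence
    \<open>B < Suc mq\<close>.\<close>
  also have "\<dots> < int (Suc mq) * fact (Suc mq)"
    using B by (intro mult_strict_right_mono) auto
  also have "\<dots> = weight mq" by (simp only: weight_def of_nat_mult of_nat_fact)
  also have "\<dots> \<le> \<bar>?t m\<bar>"
    using m w0[of mq] by (subst abs_t) (auto simp: J_def mult_le_cancel_right1)
  finally have *: "\<bar>c0 + (\<Sum>i\<in>J-{m}. ?t i)\<bar> < \<bar>?t m\<bar>" .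
  have "(\<Sum>i\<in>I. ?t i) = (\<Sum>i\<in>J. ?t i)"
    using assms(1) by (intro sum.mono_neutral_right) (auto simp: J_def)
  also have "\<dots> = ?t m + (\<Sum>i\<in>J-{m}. ?t i)" using J m by (intro sum.remove) auto
  finally show ?thesis using * by linarith
qed

text \<open>The commutator of \<open>a_i\<close> and \<open>b_j\<close> for
  \<open>v = i - j\<close>. Here \<open>h\<close> tells which programs halt with 0 or 1,
  \<open>q\<close> gives the index of their weight and \<open>s\<close> the sign. In the target,
  exponent 0 carries \<open>w\<close> and exponent \<open>n + 1\<close> a free generator for the
  program \<open>n\<close>; for negative \<open>v\<close> the commutator is trivial.\<close>

definition central_value :: "(nat \<Rightarrow> bool) \<Rightarrow> (nat \<Rightarrow> nat) \<Rightarrow> (nat \<Rightarrow> int) \<Rightarrow> int \<Rightarrow> nat \<Rightarrow>\<^sub>0 int" where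
  "central_value h q s v =
    (if v < 0 then 0 else if v = 0 then 1
     else if h (nat (v - 1)) then of_int (s (nat (v - 1)) * weight (q (nat (v - 1))))
     else single (nat v) 1)"

text \<open>
  An index whose stamp exceeds \<open>M\<close> is given an artificial weight above \<open>M\<close>: on coefficients
  bounded by \<open>M\<close> this is as good as its unknown true value.
\<close>

definition central_approx :: "(nat \<Rightarrow> bool) \<Rightarrow> (nat \<Rightarrow> nat) \<Rightarrow> (nat \<Rightarrow> int) \<Rightarrow> nat \<Rightarrow> int \<Rightarrow> int" where
  "central_approx h q s M v =
    (if v < 0 then 0 else if v = 0 then 1
     else if h (nat (v - 1)) \<and> q (nat (v - 1)) \<le> M then s (nat (v - 1)) * weight (q (nat (v - 1)))
     else weight (Suc M + nat (v - 1)))"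

lemma of_int_mult_single: "of_int a * single n b = (single n (a * b) :: nat \<Rightarrow>\<^sub>0 int)"
proof -
  have "of_int a = (single 0 a :: nat \<Rightarrow>\<^sub>0 int)"
    using single_of_int[of a, where ?'b = int, symmetric] by (simp only: of_int_eq_id id_apply)
  then show ?thesis by (simp add: mult_single)
qed

text \<open>If only programs with stamp at most \<open>M\<close> occur, both values agree. Otherwise
  neither vanishes: the approximation contains a dominating weight, and the true value contains
  either such a weight or a free generator.\<close>

lemma lin_central_eq_0_iff:
  fixes Q :: laurent
  assumes inj: "inj_on q (Collect h)" and s: "\<And>n. \<bar>s n\<bar> = 1"
    and bound: "\<And>n. \<bar>coef Q n\<bar> \<le> int M"
  shows "lin (central_value h q s) Q = 0 \<longleftrightarrow> lin (central_approx h q s M) Q = 0"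
proof -
  define c where "c n = coef Q (int n + 1)" for n
  define c0 where "c0 = coef Q 0"
  define I where "I = {n. c n \<noteq> 0}"
  have I: "finite I" unfolding I_def c_def by (rule keys_nonneg_finite)
  let ?w = "\<lambda>n. s n * weight (q n)"
  let ?v = "\<lambda>n. if h n then of_int (?w n) else single (Suc n) 1 :: nat \<Rightarrow>\<^sub>0 int"
  let ?a = "\<lambda>n. if h n \<and> q n \<le> M then ?w n else weight (Suc M + n)"
  have nat_eq: "nat (int n + 1) = Suc n" "nat (int n + 1 - 1) = n" for n by auto
  have v: "lin (central_value h q s) Q = of_int c0 + (\<Sum>n\<in>I. of_int (c n) * ?v n)"
    by (subst lin_supported_nonneg) (simp_all add: central_value_def c_def c0_def I_def nat_eq cong: if_cong)
  have a: "lin (central_approx h q s M) Q = c0 + (\<Sum>n\<in>I. c n * ?a n)"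
    by (subst lin_supported_nonneg) (simp_all add: central_approx_def c_def c0_def I_def cong: if_cong)
  show ?thesis
  proof (cases "\<forall>n\<in>I. h n \<and> q n \<le> M")
    case True
    then have "lin (central_value h q s) Q = of_int (lin (central_approx h q s M) Q)"
      unfolding v a by (simp cong: sum.cong)
    then show ?thesis by simp
  next
    case False
    then obtain n0 where n0: "n0 \<in> I" "\<not> (h n0 \<and> q n0 \<le> M)" by auto
    \<comment> \<open>The artificial indices lie above \<open>M\<close>, so they differ from each
      other and from the true indices that are kept.\<close>
    define q' where "q' n = (if h n \<and> q n \<le> M then q n else Suc M + n)" for n
    define s' where "s' n = (if h n \<and> q n \<le> M then s n else 1)" for n
    have "c0 + (\<Sum>n\<in>I. c n * (s' n * weight (q' n))) \<noteq> 0"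
    proof (rule weighted_sum_nonzero[OF I, where B = M])
      show "inj_on q' I" using inj by (auto simp: inj_on_def q'_def)
    qed (use n0 bound s in \<open>auto simp: c_def c0_def s'_def q'_def I_def\<close>)
    moreover have "?a n = s' n * weight (q' n)" for n by (simp add: s'_def q'_def)
    ultimately have 1: "lin (central_approx h q s M) Q \<noteq> 0" unfolding a by simp
    have "lin (central_value h q s) Q \<noteq> 0"
    proof (cases "I \<subseteq> Collect h")
      case True
      \<comment> \<open>Here every index has its true weight, and that of \<open>n0\<close> has
        stamp above \<open>M\<close>, so it cannot be cancelled.\<close>
      have "c0 + (\<Sum>n\<in>I. c n * ?w n) \<noteq> 0"
      proof (rule weighted_sum_nonzero[OF I, where B = M])
        show "inj_on q I" using inj True by (rule inj_on_subset)
      qed (use n0 True bound s in \<open>auto simp: c_def c0_def I_def\<close>)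
      moreover have "lin (central_value h q s) Q = of_int (c0 + (\<Sum>n\<in>I. c n * ?w n))"
        unfolding v using True by (auto intro!: sum.cong)
      ultimately show ?thesis by (simp only: of_int_eq_0_iff not_False_eq_True)
    next
      case False
      then obtain m where m: "m \<in> I" "\<not> h m" by auto
      \<comment> \<open>The program \<open>m\<close> contributes the free generator at
        \<open>Suc m\<close>, which occurs in no other term.\<close>
      have "coef (lin (central_value h q s) Q) (Suc m)
          = (\<Sum>n\<in>I. coef (of_int (c n) * ?v n) (Suc m))"
        unfolding v lookup_add lookup_sum by (simp add: lookup_of_int)
      also have "\<dots> = (\<Sum>n\<in>I. if n = m then c n else 0)"
      proof (rule sum.cong[OF refl])
        fix n assume "n \<in> I"
        show "coef (of_int (c n) * ?v n) (Suc m) = (if n = m then c n else 0)"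
          using m(2) by (auto simp: of_int_mult_single lookup_of_int lookup_single when_def
              simp flip: of_int_mult)
      qed
      also have "\<dots> = c m" using I m by simp
      finally show ?thesis using m by (auto simp: I_def)
    qed
    with 1 show ?thesis by simp
  qed
qed

section \<open>Hall groups and numberings\<close>

text \<open>\<open>f\<close> and \<open>g\<close> record the exponents of the \<open>a_i\<close> and
  \<open>b_j\<close>, with \<open>b_j\<close> placed at exponent \<open>- j\<close>. Hence
  \<open>a_i\<close> and \<open>b_j\<close> multiply to the monomial at \<open>i - j\<close>, on
  which their commutator depends. The summand with \<open>L\<close> is the cocycle of the central
  extension.\<close>

definition hall_mult :: "(laurent \<Rightarrow> 'c::ab_group_add) \<Rightarrow> int \<times> laurent \<times> laurent \<times> 'c
    \<Rightarrow> int \<times> laurent \<times> laurent \<times> 'c \<Rightarrow> int \<times> laurent \<times> laurent \<times> 'c" where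
  "hall_mult L = (\<lambda>(k, f, g, z) (k', f', g', z').
     (k + k', f + tpow k * f', g + tpow (- k) * g', z + z' + L (f * (tpow (- k) * g'))))"

definition hall_group :: "(laurent \<Rightarrow> 'c::ab_group_add) \<Rightarrow> (int \<times> laurent \<times> laurent \<times> 'c) monoid" where
  "hall_group L = \<lparr>carrier = UNIV, mult = hall_mult L, one = (0, 0, 0, 0)\<rparr>"

lemma carrier_hall_group [simp]: "carrier (hall_group L) = UNIV"
  and one_hall_group: "\<one>\<^bsub>hall_group L\<^esub> = (0, 0, 0, 0)"
  and mult_hall_group: "(k, f, g, z) \<otimes>\<^bsub>hall_group L\<^esub> (k', f', g', z') =
     (k + k', f + tpow k * f', g + tpow (- k) * g', z + z' + L (f * (tpow (- k) * g')))"
  by (simp_all add: hall_group_def hall_mult_def)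

locale additive_functional =
  fixes L :: "laurent \<Rightarrow> 'c::linordered_ab_group_add"
  assumes L_add: "L (f + g) = L f + L g"
begin

lemma L_0 [simp]: "L 0 = 0"
  using L_add[of 0 0] by simp

lemma L_uminus: "L (- f) = - L f"
  using L_add[of f "- f"] by (simp add: eq_neg_iff_add_eq_0 add.commute)

text \<open>The cocycle is invariant under \<open>t\<close>, which shifts its two factors in
  opposite directions, so that the shifts cancel in the product.\<close>

lemma hall_assoc:
  "(x \<otimes>\<^bsub>hall_group L\<^esub> y) \<otimes>\<^bsub>hall_group L\<^esub> w = x \<otimes>\<^bsub>hall_group L\<^esub> (y \<otimes>\<^bsub>hall_group L\<^esub> w)"
proof -
  obtain k f g z where x: "x = (k, f, g, z)" by (metis prod_cases4)
  obtain k' f' g' z' where y: "y = (k', f', g', z')" by (metis prod_cases4)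
  obtain k'' f'' g'' z'' where w: "w = (k'', f'', g'', z'')" by (metis prod_cases4)
  have "tpow k * (tpow (- k') * tpow (- k)) = tpow (- k')" by (simp add: mult_single)
  moreover have "tpow (- k' - k) = tpow (- k') * tpow (- k)" by (simp add: mult_single)
  ultimately show ?thesis
    unfolding x y w mult_hall_group by (simp add: tpow_add algebra_simps L_add)
qed

lemma group_hall: "group (hall_group L)"
proof (rule groupI)
  fix x assume "x \<in> carrier (hall_group L)"
  obtain k f g z where x: "x = (k, f, g, z)" by (metis prod_cases4)
  show "\<one>\<^bsub>hall_group L\<^esub> \<otimes>\<^bsub>hall_group L\<^esub> x = x"
    by (simp add: x one_hall_group mult_hall_group)
  have t: "tpow (- k) * tpow k = 1" by (simp add: mult_single)
  have "tpow (- k) * f * (tpow k * g) = (tpow (- k) * tpow k) * (f * g)" by (simp only: mult_ac)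
  then have eq: "tpow (- k) * f * (tpow k * g) = f * g" unfolding t by simp
  \<comment> \<open>The central entry \<open>L (f * g) - z\<close> compensates for the cocycle of
    the two factors.\<close>
  have "(- k, - (tpow (- k) * f), - (tpow k * g), L (f * g) - z) \<otimes>\<^bsub>hall_group L\<^esub> x = \<one>\<^bsub>hall_group L\<^esub>"
    by (simp add: x one_hall_group mult_hall_group L_uminus eq)
  then show "\<exists>y\<in>carrier (hall_group L). y \<otimes>\<^bsub>hall_group L\<^esub> x = \<one>\<^bsub>hall_group L\<^esub>" by auto
qed (simp_all add: hall_assoc)

text \<open>Left multiplication translates the first entry and shifts and translates the next two.
  If these agree, the cocycle adds the same amount on both sides, so the lexicographic order is
  kept.\<close>

lemma left_ordering_hall: "left_ordering (hall_group L) {(x, y). x \<le> y}"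
  unfolding left_ordering_def
proof (intro conjI ballI impI)
  show "linear_order_on (carrier (hall_group L)) {(x, y). x \<le> y}"
    by (auto simp: linear_order_on_def partial_order_on_def preorder_on_def refl_on_def trans_def
        antisym_def total_on_def)
next
  fix x y w :: "int \<times> laurent \<times> laurent \<times> 'c"
  assume le: "(x, y) \<in> {(x, y). x \<le> y}"
  obtain k f g z where x: "x = (k, f, g, z)" by (metis prod_cases4)
  obtain k' f' g' z' where y: "y = (k', f', g', z')" by (metis prod_cases4)
  obtain k'' f'' g'' z'' where w: "w = (k'', f'', g'', z'')" by (metis prod_cases4)
  show "(w \<otimes>\<^bsub>hall_group L\<^esub> x, w \<otimes>\<^bsub>hall_group L\<^esub> y) \<in> {(x, y). x \<le> y}"
    using le tpow_mult_less[of f f' k''] tpow_mult_less[of g g' "- k''"]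
    unfolding x y w mult_hall_group by (auto simp: le_less)
qed

end

section \<open>Pulling back orderings, and computable copies from numberings\<close>

lemma left_orderable_inj_hom:
  assumes "left_ordering G R" "h \<in> hom H G" "inj_on h (carrier H)" "group H"
  shows "left_orderable H"
proof -
  define R' where "R' = {(x, y). x \<in> carrier H \<and> y \<in> carrier H \<and> (h x, h y) \<in> R}"
  have R: "linear_order_on (carrier G) R"
    "\<And>a b c. a \<in> carrier G \<Longrightarrow> b \<in> carrier G \<Longrightarrow> c \<in> carrier G \<Longrightarrow> (a, b) \<in> R
      \<Longrightarrow> (c \<otimes>\<^bsub>G\<^esub> a, c \<otimes>\<^bsub>G\<^esub> b) \<in> R"
    using assms(1) by (auto simp: left_ordering_def)
  interpret group H by fact
  have h: "\<And>x. x \<in> carrier H \<Longrightarrow> h x \<in> carrier G"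
    "\<And>x y. x \<in> carrier H \<Longrightarrow> y \<in> carrier H \<Longrightarrow> h (x \<otimes>\<^bsub>H\<^esub> y) = h x \<otimes>\<^bsub>G\<^esub> h y"
    using assms(2) by (auto simp: hom_def)
  have "refl_on (carrier G) R" "trans R" "antisym R" "total_on (carrier G) R"
    using R(1) by (auto simp: order_on_defs)
  moreover from this have "total_on (carrier H) R'"
    using h(1) assms(3) unfolding total_on_def inj_on_def R'_def by blast
  ultimately have "refl_on (carrier H) R'" "trans R'" "antisym R'" "total_on (carrier H) R'"
    "R' \<subseteq> carrier H \<times> carrier H"
    using h(1) assms(3)
    by (auto simp: R'_def refl_on_def inj_on_def intro!: transI antisymI dest: transD antisymD)
  then have "linear_order_on (carrier H) R'" by (simp add: order_on_defs)
  then have "left_ordering H R'"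
    using R(2) h by (auto simp: left_ordering_def R'_def)
  then show ?thesis by (auto simp: left_orderable_def)
qed

text \<open>The elements are renumbered by their least \<open>\<nu>\<close>-indices.\<close>

lemma computable_group_of_numbering:
  fixes G :: "('a, 'b) monoid_scheme" (structure) and \<nu> :: "nat \<Rightarrow> 'a"
  assumes "group G" and carrier: "carrier G = range \<nu>" and inf: "infinite (range \<nu>)"
    and hom: "\<And>x y. \<nu> (op x y) = \<nu> x \<otimes>\<^bsub>G\<^esub> \<nu> y"
    and op: "recursive (\<lambda>z. op (pfst z) (psnd z))"
    and eq: "decidable (\<lambda>z. \<nu> (pfst z) = \<nu> (psnd z))"
  obtains H where "computable_group H" "H \<cong> G"
proof -
  interpret group G by fact
  define D where "D = {x. \<forall>y<x. \<nu> y \<noteq> \<nu> x}"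
  have D_ex: "\<exists>x\<in>D. \<nu> x = \<nu> y" for y
  proof -
    let ?x = "LEAST x. \<nu> x = \<nu> y"
    have "\<nu> ?x = \<nu> y" by (rule LeastI) (rule refl)
    moreover from this have "?x \<in> D" unfolding D_def using not_less_Least by fastforce
    ultimately show ?thesis by blast
  qed
  then have D_range: "\<nu> ` D = range \<nu>" by (auto simp: image_iff) metis
  then have infD: "infinite D" using inf by (metis finite_imageI)
  have inj_nu: "inj_on \<nu> D"
    unfolding inj_on_def D_def by (metis (mono_tags, lifting) linorder_less_linear mem_Collect_eq)
  define e where "e = enumerate D"
  have e_bij: "bij_betw e UNIV D" unfolding e_def using infD by (rule bij_enumerate)
  define \<mu> where "\<mu> = \<nu> \<circ> e"
  have \<mu>_bij: "bij_betw \<mu> UNIV (carrier G)"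
    unfolding \<mu>_def carrier using e_bij
    by (rule bij_betw_trans) (use inj_nu D_range in \<open>auto simp: bij_betw_def\<close>)
  have decD: "decidable (\<lambda>x. x \<in> D)"
    unfolding D_def mem_Collect_eq by (intro rec_intros decidable_comp2[OF eq])
  have "recursive e"
  proof -
    \<comment> \<open>\<open>e\<close> is obtained by iterating the search for the next element of
      \<open>D\<close>, which always ends because \<open>D\<close> is infinite.\<close>
    define next_D where "next_D u = (LEAST s. s \<in> D \<and> u < s)" for u
    have next_D: "recursive next_D" unfolding next_D_def
    proof (rule recursive_Least)
      show "decidable (\<lambda>z. pfst z \<in> D \<and> psnd z < pfst z)"
        by (intro rec_intros decidable_comp[OF decD])
      show "\<exists>s. s \<in> D \<and> u < s" for u
        using infD by (meson infinite_nat_iff_unbounded)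
    qed
    have "recursive (\<lambda>n. rec_nat (e 0) (\<lambda>_ u. next_D u) n)"
      by (intro recursive_rec_nat rec_intros recursive_comp[OF next_D])
    moreover have "rec_nat (e 0) (\<lambda>_ u. next_D u) n = e n" for n
      using infD by (induction n) (simp_all add: e_def enumerate_Suc'' next_D_def)
    ultimately show ?thesis by simp
  qed
  \<comment> \<open>The product is found by search: each value of \<open>\<nu>\<close> is attained
    on \<open>D\<close>, and equality of values is decidable.\<close>
  define m where "m x y = (LEAST n. \<nu> (e n) = \<nu> (op (e x) (e y)))" for x y
  have m_ex: "\<exists>n. \<nu> (e n) = \<nu> y" for y
    using D_ex[of y] e_bij by (metis bij_betw_imp_surj_on imageE)
  have \<mu>_m: "\<mu> (m x y) = \<mu> x \<otimes> \<mu> y" for x y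
    unfolding m_def \<mu>_def using LeastI_ex[OF m_ex[of "op (e x) (e y)"]] by (simp add: hom)
  have "recursive (\<lambda>z. m (pfst z) (psnd z))"
    unfolding m_def
  proof (rule recursive_Least)
    show "decidable (\<lambda>w. \<nu> (e (pfst w)) = \<nu> (op (e (pfst (psnd w))) (e (psnd (psnd w)))))"
      by (intro rec_intros decidable_comp2[OF eq] recursive_comp2[OF op] recursive_comp[OF \<open>recursive e\<close>])
  qed (rule m_ex)
  then obtain r where r: "\<And>z. rec_eval r [z] (m (pfst z) (psnd z))"
    unfolding recursive_def by auto
  have "rec_eval (Comp r [pair_prog]) [x, y] (m x y)" for x y
    using rec_eval_Comp1[OF pair_prog r, of x y] by simp
  then have comp: "computable_binop m" unfolding computable_binop_def by blast
  define H :: "nat monoid" where "H = \<lparr>carrier = UNIV, mult = m, one = inv_into UNIV \<mu> \<one>\<rparr>"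
  have inj: "inj \<mu>" and ran: "range \<mu> = carrier G" using \<mu>_bij by (auto simp: bij_betw_def)
  have in_G: "\<mu> x \<in> carrier G" for x using ran by auto
  have \<mu>_one: "\<mu> (inv_into UNIV \<mu> \<one>) = \<one>" by (rule f_inv_into_f) (simp add: ran)
  have "group H"
  proof (rule groupI)
    fix x y z
    show "x \<otimes>\<^bsub>H\<^esub> y \<otimes>\<^bsub>H\<^esub> z = x \<otimes>\<^bsub>H\<^esub> (y \<otimes>\<^bsub>H\<^esub> z)"
      by (rule injD[OF inj]) (simp add: H_def \<mu>_m m_assoc in_G)
    show "\<one>\<^bsub>H\<^esub> \<otimes>\<^bsub>H\<^esub> x = x"
      by (rule injD[OF inj]) (simp add: H_def \<mu>_m \<mu>_one in_G)
    obtain y where y: "\<mu> y = inv \<mu> x" using ran in_G[of x] by (metis imageE inv_closed)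
    have "y \<otimes>\<^bsub>H\<^esub> x = \<one>\<^bsub>H\<^esub>"
      by (rule injD[OF inj]) (simp add: H_def \<mu>_m \<mu>_one y in_G)
    then show "\<exists>y\<in>carrier H. y \<otimes>\<^bsub>H\<^esub> x = \<one>\<^bsub>H\<^esub>" by (auto simp: H_def)
  qed (simp_all add: H_def)
  then have "computable_group H" using comp by (simp add: computable_group_def H_def)
  moreover have "\<mu> \<in> iso H G"
    using \<mu>_bij in_G by (auto simp: iso_def hom_def H_def \<mu>_m)
  ultimately show ?thesis using that by (auto simp: is_iso_def)
qed

section \<open>Words and their values\<close>

definition irecursive :: "(nat \<Rightarrow> int) \<Rightarrow> bool" where
  "irecursive f \<longleftrightarrow> (\<exists>p q. recursive p \<and> recursive q \<and> f = (\<lambda>e. int (p e) - int (q e)))"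

lemma irecursiveI:
  "recursive p \<Longrightarrow> recursive q \<Longrightarrow> (\<And>e. f e = int (p e) - int (q e)) \<Longrightarrow> irecursive f"
  unfolding irecursive_def by (intro exI[of _ p] exI[of _ q]) auto

lemma irecursiveE:
  assumes "irecursive f"
  obtains p q where "recursive p" "recursive q" "f = (\<lambda>e. int (p e) - int (q e))"
  using assms unfolding irecursive_def by blast

lemma irecursive_int [rec_intros]: "recursive f \<Longrightarrow> irecursive (\<lambda>e. int (f e))"
  by (rule irecursiveI[of f "\<lambda>_. 0"]) (auto intro: rec_intros)

lemma irecursive_const [rec_intros]: "irecursive (\<lambda>e. c)"
  by (rule irecursiveI[of "\<lambda>_. nat c" "\<lambda>_. nat (- c)"]) (auto intro: rec_intros)

lemma irecursive_comp: "irecursive f \<Longrightarrow> recursive g \<Longrightarrow> irecursive (\<lambda>e. f (g e))"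
  by (elim irecursiveE, rule irecursiveI) (auto intro: recursive_comp)

lemma irecursive_comp2:
  assumes "irecursive (\<lambda>z. f (pfst z) (psnd z))" "recursive g" "recursive h"
  shows "irecursive (\<lambda>e. f (g e) (h e))"
  using irecursive_comp[OF assms(1) recursive_pair[OF assms(2,3)]] by simp

lemma irecursive_diff [rec_intros]:
  assumes "irecursive f" "irecursive g" shows "irecursive (\<lambda>e. f e - g e)"
proof -
  from assms obtain p q p' q' where "recursive p" "recursive q" "recursive p'" "recursive q'"
    "f = (\<lambda>e. int (p e) - int (q e))" "g = (\<lambda>e. int (p' e) - int (q' e))" by (elim irecursiveE)
  then show ?thesis
    by (intro irecursiveI[of "\<lambda>e. p e + q' e" "\<lambda>e. q e + p' e"]) (auto intro: rec_intros)
qed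

lemma irecursive_uminus [rec_intros]: "irecursive f \<Longrightarrow> irecursive (\<lambda>e. - f e)"
  using irecursive_diff[OF irecursive_const[of 0]] by simp

lemma irecursive_mult [rec_intros]:
  assumes "irecursive f" "irecursive g" shows "irecursive (\<lambda>e. f e * g e)"
proof -
  from assms obtain p q p' q' where "recursive p" "recursive q" "recursive p'" "recursive q'"
    "f = (\<lambda>e. int (p e) - int (q e))" "g = (\<lambda>e. int (p' e) - int (q' e))" by (elim irecursiveE)
  then show ?thesis
    by (intro irecursiveI[of "\<lambda>e. p e * p' e + q e * q' e" "\<lambda>e. p e * q' e + q e * p' e"])
      (auto intro: rec_intros simp: algebra_simps)
qed

lemma irecursive_if [rec_intros]:
  assumes "decidable P" "irecursive f" "irecursive g"
  shows "irecursive (\<lambda>e. if P e then f e else g e)"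
proof -
  from assms obtain p q p' q' where "recursive p" "recursive q" "recursive p'" "recursive q'"
    "f = (\<lambda>e. int (p e) - int (q e))" "g = (\<lambda>e. int (p' e) - int (q' e))" by (elim irecursiveE)
  then show ?thesis using assms(1)
    by (intro irecursiveI[of "\<lambda>e. if P e then p e else p' e" "\<lambda>e. if P e then q e else q' e"])
      (auto intro: rec_intros)
qed

lemma irecursive_sum [rec_intros]:
  assumes "recursive b" "irecursive (\<lambda>z. f (pfst z) (psnd z))"
  shows "irecursive (\<lambda>e. \<Sum>i<b e. f i e)"
proof -
  from assms(2) obtain p q where pq: "recursive p" "recursive q"
    and f: "(\<lambda>z. f (pfst z) (psnd z)) = (\<lambda>z. int (p z) - int (q z))" by (elim irecursiveE)
  have "f i e = int (p (prod_encode (i, e))) - int (q (prod_encode (i, e)))" for i e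
    using fun_cong[OF f, of "prod_encode (i, e)"] by simp
  then show ?thesis using assms(1)
    by (intro irecursiveI[of "\<lambda>e. \<Sum>i<b e. p (prod_encode (i, e))" "\<lambda>e. \<Sum>i<b e. q (prod_encode (i, e))"])
      (auto intro!: rec_intros recursive_comp[OF pq(1)] recursive_comp[OF pq(2)] simp: sum_subtractf)
qed

lemma recursive_nat [rec_intros]:
  assumes "irecursive f" shows "recursive (\<lambda>e. nat (f e))"
proof -
  obtain p q where pq: "recursive p" "recursive q" "f = (\<lambda>e. int (p e) - int (q e))"
    using assms by (rule irecursiveE)
  then have "(\<lambda>e. nat (f e)) = (\<lambda>e. p e - q e)" by (simp add: nat_diff_distrib')
  then show ?thesis using recursive_sub[OF pq(2,1)] by simp
qed

lemma decidable_iless [rec_intros]: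
  assumes "irecursive f" "irecursive g" shows "decidable (\<lambda>e. f e < g e)"
proof -
  have "decidable (\<lambda>e. 0 < nat (g e - f e))" by (intro rec_intros assms)
  then show ?thesis by simp
qed

lemma decidable_ieq [rec_intros]:
  assumes "irecursive f" "irecursive g" shows "decidable (\<lambda>e. f e = g e)"
proof -
  have "decidable (\<lambda>e. \<not> f e < g e \<and> \<not> g e < f e)" by (intro rec_intros assms)
  moreover have "(\<lambda>e. f e = g e) = (\<lambda>e. \<not> f e < g e \<and> \<not> g e < f e)" by auto
  ultimately show ?thesis by (simp only:)
qed

lemma irecursive_weight [rec_intros]:
  assumes "recursive f" shows "irecursive (\<lambda>e. weight (f e))"
  unfolding weight_def by (intro rec_intros assms)

text \<open>
  The letters 1 to 6 denote \<open>t\<close>, \<open>t\<^sup>-\<^sup>1\<close>, \<open>a\<close>, \<open>a\<^sup>-\<^sup>1\<close>, \<open>b\<close>, \<open>b\<^sup>-\<^sup>1\<close> and all others the identity, so that the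
  junk value 0 of \<^const>\<open>nth_code\<close> beyond the end of a word is harmless.
\<close>

definition t_exp :: "nat \<Rightarrow> int" where "t_exp l = (if l = 1 then 1 else if l = 2 then - 1 else 0)"
definition a_exp :: "nat \<Rightarrow> int" where "a_exp l = (if l = 3 then 1 else if l = 4 then - 1 else 0)"
definition b_exp :: "nat \<Rightarrow> int" where "b_exp l = (if l = 5 then 1 else if l = 6 then - 1 else 0)"

lemma irecursive_exps [rec_intros]:
  assumes "recursive f"
  shows "irecursive (\<lambda>e. t_exp (f e))" "irecursive (\<lambda>e. a_exp (f e))" "irecursive (\<lambda>e. b_exp (f e))"
  unfolding t_exp_def a_exp_def b_exp_def by (intro rec_intros assms)+

section \<open>Evaluation of words over the generators\<close>

definition letter_val :: "nat \<Rightarrow> int \<times> laurent \<times> laurent \<times> 'c::ab_group_add" where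
  "letter_val l = (t_exp l, single 0 (a_exp l), single 0 (b_exp l), 0)"

primrec prefix_val :: "(laurent \<Rightarrow> 'c::ab_group_add) \<Rightarrow> (nat \<Rightarrow> nat) \<Rightarrow> nat \<Rightarrow> int \<times> laurent \<times> laurent \<times> 'c" where
  "prefix_val L u 0 = \<one>\<^bsub>hall_group L\<^esub>"
| "prefix_val L u (Suc N) = prefix_val L u N \<otimes>\<^bsub>hall_group L\<^esub> letter_val (u N)"

definition height :: "(nat \<Rightarrow> nat) \<Rightarrow> nat \<Rightarrow> int" where
  "height u N = (\<Sum>i<N. t_exp (u i))"

text \<open>Each \<open>a\<close> before a \<open>b\<close> contributes a monomial at the difference
  of their heights. The result is collected before \<open>L\<close> is applied, hence computable
  without knowing the commutators.\<close>

definition central_part :: "(nat \<Rightarrow> nat) \<Rightarrow> nat \<Rightarrow> laurent" where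
  "central_part u N = (\<Sum>j<N. \<Sum>i<j. single (height u i - height u j) (a_exp (u i) * b_exp (u j)))"

context additive_functional
begin

text \<open>Unrolls the product into bounded sums, the form needed for decidability.\<close>

lemma prefix_val_eq:
  "prefix_val L u N = (height u N, \<Sum>i<N. single (height u i) (a_exp (u i)),
    \<Sum>i<N. single (- height u i) (b_exp (u i)), L (central_part u N))"
proof (induction N)
  case 0
  then show ?case by (simp add: one_hall_group height_def central_part_def)
next
  case (Suc N)
  have "height u (Suc N) = height u N + t_exp (u N)" by (simp add: height_def)
  moreover have "central_part u (Suc N) = central_part u N
      + (\<Sum>i<N. single (height u i) (a_exp (u i))) * single (- height u N) (b_exp (u N))"
    by (simp add: central_part_def sum_distrib_right mult_single)
  ultimately show ?case
    by (simp add: Suc mult_hall_group letter_val_def mult_single L_add)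
qed

lemma prefix_val_append:
  assumes "\<And>i. i < m \<Longrightarrow> w i = u i" "\<And>i. i < n \<Longrightarrow> w (m + i) = v i"
  shows "prefix_val L w (m + n) = prefix_val L u m \<otimes>\<^bsub>hall_group L\<^esub> prefix_val L v n"
proof -
  interpret group "hall_group L" by (rule group_hall)
  have m: "prefix_val L w m' = prefix_val L u m'" if "m' \<le> m" for m'
    using that by (induction m') (simp_all add: assms(1))
  have "n' \<le> n \<Longrightarrow> prefix_val L w (m + n') = prefix_val L u m \<otimes>\<^bsub>hall_group L\<^esub> prefix_val L v n'" for n'
    by (induction n') (simp_all add: m assms(2) hall_assoc)
  then show ?thesis by simp
qed

lemma letter_val_0: "letter_val 0 = \<one>\<^bsub>hall_group L\<^esub>"
  by (simp add: letter_val_def t_exp_def a_exp_def b_exp_def one_hall_group)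

text \<open>The code \<open>x\<close> is also the number of letters read: it is at least the length
  of the word, and the surplus letters are 0, the identity.\<close>

definition word_val :: "nat \<Rightarrow> int \<times> laurent \<times> laurent \<times> 'c" where
  "word_val x = prefix_val L (nth_code x) x"

lemma word_val_list_encode:
  assumes "length xs \<le> N"
  shows "word_val (list_encode xs) = prefix_val L (nth_code (list_encode xs)) N"
proof -
  interpret group "hall_group L" by (rule group_hall)
  have "prefix_val L (nth_code (list_encode xs)) (length xs + n) = prefix_val L (nth_code (list_encode xs)) (length xs)" for n
    by (induction n) (simp_all add: nth_code_list_encode letter_val_0)
  from this[of "N - length xs"] this[of "list_encode xs - length xs"] show ?thesis
    using assms length_le_list_encode[of xs] by (simp add: word_val_def)
qed

lemma word_val_append:
  "word_val (list_encode (xs @ ys)) = word_val (list_encode xs) \<otimes>\<^bsub>hall_group L\<^esub> word_val (list_encode ys)"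
  using prefix_val_append[of "length xs" "nth_code (list_encode (xs @ ys))" "nth_code (list_encode xs)"
      "length ys" "nth_code (list_encode ys)"]
  by (simp add: word_val_list_encode[of xs "length xs"] word_val_list_encode[of ys "length ys"]
      word_val_list_encode[of "xs @ ys" "length xs + length ys"]
      nth_code_list_encode nth_append)

lemma word_val_Nil: "word_val (list_encode []) = \<one>\<^bsub>hall_group L\<^esub>"
  by (simp add: word_val_def)

lemma word_val_letter: "word_val (list_encode [l]) = letter_val l"
proof -
  interpret group "hall_group L" by (rule group_hall)
  show ?thesis by (subst word_val_list_encode[of _ 1]) (simp_all add: nth_code_list_encode del: list_encode.simps)
qed

lemma word_val_inverse: "\<exists>ys. word_val (list_encode ys) \<otimes>\<^bsub>hall_group L\<^esub> word_val (list_encode xs) = \<one>\<^bsub>hall_group L\<^esub>"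
proof (induction xs)
  case Nil
  interpret group "hall_group L" by (rule group_hall)
  show ?case by (intro exI[of _ "[]"]) (simp add: word_val_Nil del: list_encode.simps)
next
  case (Cons l xs)
  interpret group "hall_group L" by (rule group_hall)
  obtain ys where ys: "word_val (list_encode ys) \<otimes>\<^bsub>hall_group L\<^esub> word_val (list_encode xs) = \<one>\<^bsub>hall_group L\<^esub>"
    using Cons by blast
  \<comment> \<open>Numbers outside 1 to 6 denote the identity and get the inverse letter 0.\<close>
  define l' :: nat where "l' = (if l = 1 then 2 else if l = 2 then 1 else if l = 3 then 4 else if l = 4 then 3
    else if l = 5 then 6 else if l = 6 then 5 else 0)"
  have l': "letter_val l' \<otimes>\<^bsub>hall_group L\<^esub> letter_val l = \<one>\<^bsub>hall_group L\<^esub>"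
    by (simp add: l'_def letter_val_def t_exp_def a_exp_def b_exp_def mult_hall_group one_hall_group
        single_uminus mult_single flip: single_add)
  have "word_val (list_encode (ys @ [l'])) \<otimes>\<^bsub>hall_group L\<^esub> word_val (list_encode ([l] @ xs))
      = word_val (list_encode ys) \<otimes>\<^bsub>hall_group L\<^esub> ((letter_val l' \<otimes>\<^bsub>hall_group L\<^esub> letter_val l) \<otimes>\<^bsub>hall_group L\<^esub> word_val (list_encode xs))"
    unfolding word_val_append word_val_letter by (simp only: hall_assoc)
  also have "\<dots> = \<one>\<^bsub>hall_group L\<^esub>" unfolding l' using ys by simp
  finally show ?case by auto
qed

text \<open>The subgroup generated by \<open>t\<close>, \<open>a\<close> and \<open>b\<close>, which
  is numbered by its words.\<close>

abbreviation word_group :: "(int \<times> laurent \<times> laurent \<times> 'c) monoid" where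
  "word_group \<equiv> hall_group L\<lparr>carrier := range word_val\<rparr>"

lemma word_val_mult:
  "word_val x \<otimes>\<^bsub>hall_group L\<^esub> word_val y = word_val (list_encode (list_decode x @ list_decode y))"
  by (simp add: word_val_append)

lemma group_word_group: "group word_group"
proof (rule groupI)
  interpret group "hall_group L" by (rule group_hall)
  show "\<one>\<^bsub>word_group\<^esub> \<in> carrier word_group" by (simp flip: word_val_Nil)
  fix x y z assume x: "x \<in> carrier word_group" and y: "y \<in> carrier word_group"
  show "x \<otimes>\<^bsub>word_group\<^esub> y \<in> carrier word_group" using x y by (auto simp: word_val_mult)
  show "x \<otimes>\<^bsub>word_group\<^esub> y \<otimes>\<^bsub>word_group\<^esub> z = x \<otimes>\<^bsub>word_group\<^esub> (y \<otimes>\<^bsub>word_group\<^esub> z)"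
    by (simp add: hall_assoc)
  show "\<one>\<^bsub>word_group\<^esub> \<otimes>\<^bsub>word_group\<^esub> x = x" by simp
  obtain n where n: "x = word_val n" using x by auto
  obtain ys where "word_val (list_encode ys) \<otimes>\<^bsub>hall_group L\<^esub> x = \<one>\<^bsub>hall_group L\<^esub>"
    using word_val_inverse[of "list_decode n"] n by auto
  then show "\<exists>y\<in>carrier word_group. y \<otimes>\<^bsub>word_group\<^esub> x = \<one>\<^bsub>word_group\<^esub>" by auto
qed

text \<open>The powers of \<open>t\<close> differ in their first entry.\<close>

lemma infinite_range_word_val: "infinite (range word_val)"
proof
  assume "finite (range word_val)"
  then have "finite (fst ` range word_val)" by (rule finite_imageI)
  moreover have "fst (word_val (list_encode (replicate n 1))) = int n" for n
  proof (induction n)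
    case 0
    then show ?case by (simp add: word_val_Nil one_hall_group del: list_encode.simps)
  next
    case (Suc n)
    obtain k f g z where v: "word_val (list_encode (replicate n 1)) = (k, f, g, z)" by (metis prod_cases4)
    have "word_val (list_encode ([1] @ replicate n 1)) = letter_val 1 \<otimes>\<^bsub>hall_group L\<^esub> (k, f, g, z)"
      unfolding word_val_append word_val_letter v ..
    then show ?case using Suc v by (simp add: letter_val_def mult_hall_group t_exp_def)
  qed
  then have "range int \<subseteq> fst ` range word_val" by (metis image_eqI image_subsetI rangeI)
  ultimately have "finite (range int)" using finite_subset by blast
  then show False using finite_imageD[of int UNIV] by (simp add: inj_on_def)
qed

end

section \<open>Decidability of the word problem\<close>

text \<open>The concatenation is found by searching for a code that meets a decidable specification,
  positions being compared one by one.\<close>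

lemma recursive_append_code:
  "recursive (\<lambda>z. list_encode (list_decode (pfst z) @ list_decode (psnd z)))"
proof -
  define P where "P w x y \<longleftrightarrow> len_code w = len_code x + len_code y \<and> (\<forall>i<len_code x. nth_code w i = nth_code x i)
    \<and> (\<forall>i<len_code y. nth_code w (len_code x + i) = nth_code y i)" for w x y
  have P_lists: "P (list_encode ws) (list_encode xs) (list_encode ys) \<longleftrightarrow> ws = xs @ ys" for ws xs ys
  proof
    assume "P (list_encode ws) (list_encode xs) (list_encode ys)"
    then have w: "length ws = length xs + length ys" "\<And>i. i < length xs \<Longrightarrow> ws ! i = xs ! i"
      "\<And>i. i < length ys \<Longrightarrow> ws ! (length xs + i) = ys ! i"
      by (auto simp: P_def nth_code_list_encode)
    show "ws = xs @ ys"
    proof (rule nth_equalityI)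
      fix i assume "i < length ws"
      then show "ws ! i = (xs @ ys) ! i"
        using w(1) w(2)[of i] w(3)[of "i - length xs"] by (auto simp: nth_append)
    qed (simp add: w)
  qed (auto simp: P_def nth_code_list_encode nth_append)
  have P_iff: "P w x y \<longleftrightarrow> w = list_encode (list_decode x @ list_decode y)" for w x y
    using P_lists[of "list_decode w" "list_decode x" "list_decode y"]
    by (metis list_decode_inverse list_encode_inverse)
  have "recursive (\<lambda>z. LEAST w. P w (pfst z) (psnd z))"
  proof (rule recursive_Least)
    show "decidable (\<lambda>z. P (pfst z) (pfst (psnd z)) (psnd (psnd z)))"
      unfolding P_def by (intro rec_intros)
    show "\<exists>w. P w (pfst z) (psnd z)" for z using P_iff by blast
  qed
  moreover have "(LEAST w. P w x y) = list_encode (list_decode x @ list_decode y)" for x y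
    unfolding P_iff by (rule Least_equality) auto
  ultimately show ?thesis by simp
qed

section \<open>Halting stages and their stamps\<close>

definition halted :: "nat \<Rightarrow> nat \<Rightarrow> bool" where "halted n d \<longleftrightarrow> outputs n 0 d \<or> outputs n 1 d"
definition halts :: "nat \<Rightarrow> bool" where "halts n \<longleftrightarrow> (\<exists>d. halted n d)"
definition stage :: "nat \<Rightarrow> nat" where "stage n = (LEAST d. halted n d)"
text \<open>Pairing with \<open>n\<close> keeps the stamps of different programs apart, while a
  stamp still bounds the stage from above.\<close>

definition stamp :: "nat \<Rightarrow> nat" where "stamp n = prod_encode (n, stage n)"
text \<open>Chosen for the diagonal argument: output 1 will claim that the commutator has the sign
  of \<open>w\<close>, and is answered by a negative power.\<close>

definition out_sign :: "nat \<Rightarrow> int" where "out_sign n = (if outputs n 0 (stage n) then 1 else - 1)"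

lemma decidable_halted [rec_intros]:
  "recursive f \<Longrightarrow> recursive g \<Longrightarrow> decidable (\<lambda>e. halted (f e) (g e))"
  unfolding halted_def by (intro rec_intros)

lemma halted_stage: "halts n \<Longrightarrow> halted n (stage n)"
  unfolding halts_def stage_def by (rule LeastI_ex)

text \<open>Whether a program halts with a stamp at most \<open>M\<close> is settled by a search up
  to stage \<open>M\<close>.\<close>

lemma irecursive_central_approx [rec_intros]:
  assumes "recursive f" "irecursive g"
  shows "irecursive (\<lambda>e. central_approx halts stamp out_sign (f e) (g e))"
proof -
  \<comment> \<open>The alternative \<open>M < d\<close> cuts the search off, so that it ends for
    every \<open>n\<close>; up to the bound it finds the true stage.\<close>
  define st where "st M n = (LEAST d. halted n d \<or> M < d)" for M n
  have st_rec: "recursive (\<lambda>z. st (pfst z) (psnd z))" unfolding st_def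
  proof (rule recursive_Least)
    show "decidable (\<lambda>z. halted (psnd (psnd z)) (pfst z) \<or> pfst (psnd z) < pfst z)"
      by (intro rec_intros)
    show "\<exists>d. halted (psnd z) d \<or> pfst z < d" for z by (rule exI[of _ "Suc (pfst z)"]) simp
  qed
  have early1: "stage n = st M n" if "halts n" "stamp n \<le> M" for n M
  proof -
    have "stage n \<le> M" using that le_prod_encode_2[of "stage n" n] by (simp add: stamp_def)
    moreover have "halted n (stage n)" using that(1) by (rule halted_stage)
    moreover have "stage n \<le> d" if "halted n d" for d
      unfolding stage_def using that by (rule Least_le)
    ultimately show ?thesis unfolding st_def by (intro Least_equality[symmetric]) (auto intro: order_trans less_imp_le)
  qed
  have early2: "stage n = st M n" if "halted n (st M n)" for n M
    unfolding stage_def using that by (rule Least_equality) (auto simp: st_def intro: Least_le)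
  have early: "halts n \<and> stamp n \<le> M \<longleftrightarrow> halted n (st M n) \<and> prod_encode (n, st M n) \<le> M" for n M
  proof
    assume a: "halts n \<and> stamp n \<le> M"
    then have "halted n (stage n)" by (simp add: halted_stage)
    then show "halted n (st M n) \<and> prod_encode (n, st M n) \<le> M"
      using a early1[of n M] by (simp add: stamp_def)
  next
    assume "halted n (st M n) \<and> prod_encode (n, st M n) \<le> M"
    then show "halts n \<and> stamp n \<le> M" using early2[of n M] by (auto simp: stamp_def halts_def)
  qed
  have eq: "central_approx halts stamp out_sign M v =
    (if v < 0 then 0 else if v = 0 then 1
     else if halted (nat (v - 1)) (st M (nat (v - 1))) \<and> prod_encode (nat (v - 1), st M (nat (v - 1))) \<le> M
     then (if outputs (nat (v - 1)) 0 (st M (nat (v - 1))) then 1 else - 1)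
       * weight (prod_encode (nat (v - 1), st M (nat (v - 1))))
     else weight (Suc M + nat (v - 1)))" for M v
    unfolding central_approx_def early using early2
    by (auto simp: stamp_def out_sign_def)
  show ?thesis unfolding eq by (intro rec_intros assms recursive_comp2[OF st_rec])
qed

text \<open>Only exponents listed on one of the two sides can carry a nonzero coefficient, so
  finitely many integer comparisons suffice.\<close>

lemma sum_single_eq_iff:
  fixes p p' c c' :: "nat \<Rightarrow> int"
  shows "(\<Sum>i<N. single (p i) (c i)) = (\<Sum>i<N'. single (p' i) (c' i)) \<longleftrightarrow>
    (\<forall>k<N. (\<Sum>i<N. if p i = p k then c i else 0) = (\<Sum>i<N'. if p' i = p k then c' i else 0)) \<and>
    (\<forall>k<N'. (\<Sum>i<N. if p i = p' k then c i else 0) = (\<Sum>i<N'. if p' i = p' k then c' i else 0))"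
    (is "?s = ?s' \<longleftrightarrow> ?R")
proof -
  have lookup: "coef (\<Sum>i<N. single (p i) (c i)) v = (\<Sum>i<N. if p i = v then c i else 0)"
    for N v and p c :: "nat \<Rightarrow> int"
    by (simp add: lookup_sum lookup_single when_def)
  have zero: "(\<Sum>i<N. if p i = v then c i else 0) = 0" if "v \<notin> p ` {..<N}" for N v and p c :: "nat \<Rightarrow> int"
    using that by (intro sum.neutral) auto
  show ?thesis
  proof
    assume "?s = ?s'"
    then show ?R by (simp flip: lookup)
  next
    assume R: ?R
    show "?s = ?s'"
    proof (rule poly_mapping_eqI)
      fix v
      show "coef ?s v = coef ?s' v"
        unfolding lookup
        using R zero[of v p N c] zero[of v p' N' c']
        by (cases "v \<in> p ` {..<N} \<or> v \<in> p' ` {..<N'}") auto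
    qed
  qed
qed

text \<open>Each pair of positions contributes at most 1 in absolute value. This bounds the
  coefficients on which the approximation must be faithful.\<close>

lemma abs_lookup_central_part: "\<bar>coef (central_part u N) v\<bar> \<le> int (N * N)"
proof -
  have "\<bar>coef (central_part u N) v\<bar>
      \<le> (\<Sum>j<N. \<Sum>i<j. \<bar>coef (single (height u i - height u j) (a_exp (u i) * b_exp (u j))) v\<bar>)"
    unfolding central_part_def lookup_sum by (intro order_trans[OF sum_abs] sum_mono sum_abs)
  also have "\<dots> \<le> (\<Sum>j<N. \<Sum>i<j. 1)"
    by (intro sum_mono) (auto simp: lookup_single when_def a_exp_def b_exp_def)
  also have "\<dots> \<le> (\<Sum>j<N. int N)" by (intro sum_mono) simp
  finally show ?thesis by simp
qed

abbreviation commutator_value :: "int \<Rightarrow> nat \<Rightarrow>\<^sub>0 int" where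
  "commutator_value \<equiv> central_value halts stamp out_sign"

interpretation hall: additive_functional "lin commutator_value"
  by standard (rule lin_add)

text \<open>The central entries agree iff the functional vanishes on the difference of the central
  parts. Its coefficients are at most \<open>x * x + y * y\<close>, so at this bound the
  approximation may replace the true commutators.\<close>

lemma word_val_eq_iff:
  fixes x y :: nat
  defines "u \<equiv> nth_code x" and "w \<equiv> nth_code y"
  shows "hall.word_val x = hall.word_val y \<longleftrightarrow>
    height u x = height w y
  \<and> (\<Sum>i<x. single (height u i) (a_exp (u i))) = (\<Sum>i<y. single (height w i) (a_exp (w i)))
  \<and> (\<Sum>i<x. single (- height u i) (b_exp (u i))) = (\<Sum>i<y. single (- height w i) (b_exp (w i)))
  \<and> lin (central_approx halts stamp out_sign (x * x + y * y)) (central_part u x)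
    = lin (central_approx halts stamp out_sign (x * x + y * y)) (central_part w y)"
proof -
  let ?Q = "central_part u x - central_part w y"
  have "lin commutator_value ?Q = 0 \<longleftrightarrow> lin (central_approx halts stamp out_sign (x * x + y * y)) ?Q = 0"
  proof (rule lin_central_eq_0_iff)
    show "inj_on stamp (Collect halts)" by (auto simp: inj_on_def stamp_def)
    show "\<bar>out_sign n\<bar> = 1" for n by (simp add: out_sign_def)
    show "\<bar>coef ?Q n\<bar> \<le> int (x * x + y * y)" for n
      using abs_lookup_central_part[of u x n] abs_lookup_central_part[of w y n]
      unfolding lookup_minus by simp
  qed
  then show ?thesis
    by (simp add: hall.word_val_def hall.prefix_val_eq lin_diff flip: u_def w_def)
qed

lemma irecursive_height [rec_intros]:
  assumes "recursive f" "recursive g" shows "irecursive (\<lambda>e. height (nth_code (f e)) (g e))"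
  unfolding height_def
  by (intro rec_intros assms recursive_comp[OF assms(1)] recursive_comp[OF assms(2)])

lemma irecursive_lin_central_part:
  "irecursive (\<lambda>z. lin (central_approx halts stamp out_sign (pfst z)) (central_part (nth_code (psnd z)) (psnd z)))"
  unfolding central_part_def lin_sum lin_single of_int_eq_id id_apply by (intro rec_intros)

lemma decidable_word_val_eq: "decidable (\<lambda>z. hall.word_val (pfst z) = hall.word_val (psnd z))"
  unfolding word_val_eq_iff sum_single_eq_iff
  by (intro rec_intros irecursive_comp2[OF irecursive_lin_central_part])

section \<open>Diagonalisation against computable left-orderings\<close>

locale left_ordered_group = group G for G (structure) +
  fixes R
  assumes left_ordering: "left_ordering G R"
begin

definition nonneg where "nonneg x \<longleftrightarrow> (\<one>, x) \<in> R"

lemma order: "trans R" "antisym R" "total_on (carrier G) R" "refl_on (carrier G) R"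
  and mult_left: "x \<in> carrier G \<Longrightarrow> y \<in> carrier G \<Longrightarrow> z \<in> carrier G \<Longrightarrow> (x, y) \<in> R \<Longrightarrow> (z \<otimes> x, z \<otimes> y) \<in> R"
  using left_ordering by (auto simp: left_ordering_def order_on_defs)

lemma nonneg_mult:
  assumes "x \<in> carrier G" "y \<in> carrier G" "nonneg x" "nonneg y" shows "nonneg (x \<otimes> y)"
  using mult_left[of \<one> y x] assms transD[OF order(1)] unfolding nonneg_def by fastforce

lemma nonneg_pow:
  assumes "x \<in> carrier G" "nonneg x" shows "nonneg (x [^] (n::nat))"
proof (induction n)
  case 0
  then show ?case using order(4) by (simp add: nonneg_def refl_on_def)
next
  case (Suc n)
  then show ?case using assms by (simp add: nonneg_mult)
qed

lemma nonneg_or_inv: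
  assumes "x \<in> carrier G" shows "nonneg x \<or> nonneg (inv x)"
proof (cases "(x, \<one>) \<in> R")
  case True
  then show ?thesis using mult_left[of x \<one> "inv x"] assms by (simp add: nonneg_def)
next
  case False
  then show ?thesis using order(3,4) assms one_closed unfolding total_on_def refl_on_def nonneg_def by metis
qed

lemma nonneg_inv_imp_one:
  assumes "x \<in> carrier G" "nonneg x" "nonneg (inv x)" shows "x = \<one>"
  using mult_left[of \<one> "inv x" x] assms antisymD[OF order(2)] by (simp add: nonneg_def)

text \<open>Nonnegative elements are closed under products, so a nontrivial power has the sign of
  its base. This ties the sign of a power of \<open>w\<close> to that of \<open>w\<close>.\<close>

lemma nonneg_pow_iff:
  assumes "x \<in> carrier G" "x [^] (n::nat) \<noteq> \<one>"
  shows "nonneg (x [^] n) \<longleftrightarrow> nonneg x" "nonneg (inv (x [^] n)) \<longleftrightarrow> \<not> nonneg x"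
proof -
  have "nonneg (inv x) \<Longrightarrow> nonneg (inv (x [^] n))"
    using nonneg_pow[of "inv x" n] assms(1) by (simp add: nat_pow_inv)
  then show "nonneg (x [^] n) \<longleftrightarrow> nonneg x" "nonneg (inv (x [^] n)) \<longleftrightarrow> \<not> nonneg x"
    using nonneg_pow[of x n] nonneg_or_inv[of x] nonneg_inv_imp_one[of "x [^] n"] assms by auto
qed

end

abbreviation coded_group where "coded_group \<equiv> hall_group (lin commutator_value)"

lemma no_computable_left_ordering:
  assumes "computable_group H" and iso: "\<theta> \<in> iso H hall.word_group"
    and R: "left_ordering H R" "computable_rel R"
  shows False
proof -
  have "group H" and carrier [simp]: "carrier H = UNIV" and "computable_binop (mult H)"
    using assms(1) by (auto simp: computable_group_def)
  interpret left_ordered_group H R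
    by (rule left_ordered_group.intro) (use \<open>group H\<close> R in \<open>auto simp: left_ordered_group_axioms_def\<close>)
  obtain r where r: "\<And>x y. rec_eval r [x, y] (x \<otimes>\<^bsub>H\<^esub> y)"
    using \<open>computable_binop (mult H)\<close> by (auto simp: computable_binop_def)
  note mult_rec = recursive_prog2[OF r]
  obtain r' where r': "\<And>x y. rec_eval r' [x, y] (if (x, y) \<in> R then 1 else 0)"
    using R(2) by (auto simp: computable_rel_def computable_binop_def)
  have nonneg_rec: "decidable (\<lambda>e. nonneg (f e))" if "recursive f" for f
    using recursive_prog2[OF r' recursive_const that, of "\<one>\<^bsub>H\<^esub>"]
    by (simp add: decidable_def nonneg_def of_bool_def)
  have inj: "\<theta> x = \<theta> y \<longleftrightarrow> x = y" for x y
    using iso by (auto simp: iso_def bij_betw_def inj_on_def)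
  have mult: "\<theta> (x \<otimes>\<^bsub>H\<^esub> y) = \<theta> x \<otimes>\<^bsub>coded_group\<^esub> \<theta> y" for x y
    using iso by (auto simp: iso_def hom_def)
  interpret M: group coded_group by (rule hall.group_hall)
  have one: "\<theta> \<one>\<^bsub>H\<^esub> = (0, 0, 0, 0)"
    using mult[of "\<one>\<^bsub>H\<^esub>" "\<one>\<^bsub>H\<^esub>"] M.r_cancel_one'[of "\<theta> \<one>\<^bsub>H\<^esub>" "\<theta> \<one>\<^bsub>H\<^esub>"]
    by (simp add: one_hall_group)
  have "\<exists>x. \<theta> x = letter_val l" for l
  proof -
    have "letter_val l \<in> range hall.word_val" using hall.word_val_letter[of l] by (metis rangeI)
    moreover have "range \<theta> = range hall.word_val" using iso by (auto simp: iso_def bij_betw_def)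
    ultimately show ?thesis by (metis imageE)
  qed
  \<comment> \<open>These preimages of the letters enter the computations below as
    constants.\<close>
  then obtain el where "\<And>l. \<theta> (el l) = letter_val l" by metis
  note el = this[unfolded letter_val_def t_exp_def a_exp_def b_exp_def]
  define pw where "pw l n = rec_nat \<one>\<^bsub>H\<^esub> (\<lambda>_ u. u \<otimes>\<^bsub>H\<^esub> el l) n" for l n
  have pw1: "\<theta> (pw 1 n) = (int n, 0, 0, 0)" for n
    by (induction n) (simp_all add: pw_def one mult el mult_hall_group)
  have pw2: "\<theta> (pw 2 n) = (- int n, 0, 0, 0)" for n
    by (induction n) (simp_all add: pw_def one mult el mult_hall_group)
  have pw_rec: "recursive (\<lambda>n. pw l n)" for l
    unfolding pw_def by (intro recursive_rec_nat rec_intros mult_rec)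
  \<comment> \<open>\<open>c n\<close> is the commutator of \<open>t\<^sup>n a t\<^sup>-\<^sup>n\<close> and \<open>b\<close>, written with the letters only.\<close>
  define A where "A l n = pw 1 n \<otimes>\<^bsub>H\<^esub> el l \<otimes>\<^bsub>H\<^esub> pw 2 n" for l n
  define c where "c n = (A 3 n \<otimes>\<^bsub>H\<^esub> el 5) \<otimes>\<^bsub>H\<^esub> (A 4 n \<otimes>\<^bsub>H\<^esub> el 6)" for n
  have c_rec: "recursive c"
    unfolding c_def A_def by (intro rec_intros mult_rec pw_rec)
  have A3: "\<theta> (A 3 n) = (0, tpow (int n), 0, 0)" for n
    by (simp add: A_def mult pw1[simplified] pw2 el mult_hall_group mult_single)
  have A4: "\<theta> (A 4 n) = (0, - tpow (int n), 0, 0)" for n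
    by (simp add: A_def mult pw1[simplified] pw2 el mult_hall_group mult_single single_uminus)
  have c: "\<theta> (c n) = (0, 0, 0, commutator_value (int n))" for n
    by (simp add: c_def mult A3 A4 el mult_hall_group mult_single single_uminus hall.L_uminus)
  have pow: "\<theta> (c 0 [^]\<^bsub>H\<^esub> (p::nat)) = (0, 0, 0, of_nat p)" for p
    by (induction p) (simp_all add: mult one c mult_hall_group central_value_def)
  \<comment> \<open>\<open>f n\<close> is 1 if \<open>c (Suc n)\<close> has the same sign as
    \<open>c 0\<close>, the preimage of \<open>w\<close>, and 0 otherwise.\<close>
  define f :: "nat \<Rightarrow> nat" where "f n = of_bool (nonneg (c (Suc n)) = nonneg (c 0))" for n
  have "decidable (\<lambda>n. (nonneg (c (Suc n)) \<and> nonneg (c 0)) \<or> (\<not> nonneg (c (Suc n)) \<and> \<not> nonneg (c 0)))"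
    by (intro rec_intros nonneg_rec recursive_comp[OF c_rec])
  moreover have "(nonneg (c (Suc n)) \<and> nonneg (c 0)) \<or> (\<not> nonneg (c (Suc n)) \<and> \<not> nonneg (c 0)) \<longleftrightarrow>
      nonneg (c (Suc n)) = nonneg (c 0)" for n by blast
  ultimately have "recursive f" unfolding f_def decidable_def by simp
  \<comment> \<open>The program \<open>n\<close> computes \<open>f\<close>, and its output on input
    \<open>n\<close> is what determined \<open>c (Suc n)\<close>.\<close>
  then obtain n where n: "\<And>b. (\<exists>d. outputs n b d) \<longleftrightarrow> f n = b"
    using outputs_universal[of f] by auto
  have f01: "f n = 0 \<or> f n = 1" by (simp add: f_def)
  then have "halts n" using n[of 0] n[of 1] unfolding halts_def halted_def by blast
  then have "halted n (stage n)" by (rule halted_stage)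
  then have sign: "out_sign n = (if f n = 0 then 1 else - 1)"
    using n[of 0] n[of 1] unfolding out_sign_def halted_def by auto
  define p :: nat where "p = Suc (stamp n) * fact (Suc (stamp n))"
  have p: "0 < p" "weight (stamp n) = int p" unfolding p_def weight_def by simp_all
  have "commutator_value (int (Suc n)) = of_int (out_sign n * int p)"
    using \<open>halts n\<close> p by (simp add: central_value_def)
  then have c_Suc: "\<theta> (c (Suc n)) = (0, 0, 0, of_int (out_sign n * int p))" using c by metis
  have ne: "c 0 [^]\<^bsub>H\<^esub> p \<noteq> \<one>\<^bsub>H\<^esub>"
    using p(1) pow[of p] one by auto
  show False
  proof (cases "f n = 0")
    case True
    \<comment> \<open>The output 0 claims different signs, yet \<open>c (Suc n)\<close> is a
      positive power of \<open>c 0\<close>.\<close>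
    then have "c (Suc n) = c 0 [^]\<^bsub>H\<^esub> p" by (intro inj[THEN iffD1]) (simp add: pow c_Suc sign)
    then have "f n = 1" using nonneg_pow_iff(1)[OF _ ne] by (simp add: f_def)
    then show False using True by simp
  next
    case False
    \<comment> \<open>The output 1 claims equal signs, yet \<open>c (Suc n)\<close> is inverse to a
      positive power of \<open>c 0\<close>.\<close>
    then have "c (Suc n) \<otimes>\<^bsub>H\<^esub> c 0 [^]\<^bsub>H\<^esub> p = \<one>\<^bsub>H\<^esub>"
      by (intro inj[THEN iffD1]) (simp add: mult pow c_Suc sign one mult_hall_group)
    then have "c (Suc n) = inv\<^bsub>H\<^esub> (c 0 [^]\<^bsub>H\<^esub> p)" using inv_equality[of "c (Suc n)"] by simp
    then have "f n = 0" using nonneg_pow_iff(2)[OF _ ne] by (simp add: f_def)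
    then show False using False by simp
  qed
qed

theorem theorem1p2:
  shows "\<exists>G :: nat monoid. computable_group G \<and> left_orderable G \<and>
    \<not> (\<exists>H :: nat monoid. computable_group H \<and> H \<cong> G \<and>
         (\<exists>R. left_ordering H R \<and> computable_rel R))"
proof -
  obtain G :: "nat monoid" where G: "computable_group G" "G \<cong> hall.word_group"
  proof (rule computable_group_of_numbering[OF hall.group_word_group])
    show "carrier hall.word_group = range hall.word_val" by simp
    show "hall.word_val (list_encode (list_decode x @ list_decode y))
        = hall.word_val x \<otimes>\<^bsub>hall.word_group\<^esub> hall.word_val y" for x y
      by (simp add: hall.word_val_mult)
  qed (rule hall.infinite_range_word_val recursive_append_code decidable_word_val_eq | assumption)+
  then obtain h where h: "h \<in> iso G hall.word_group" by (auto simp: is_iso_def)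
  have "left_orderable G"
  \<comment> \<open>The word group lies in the full Hall group, whose lexicographic order is pulled
    back along \<open>h\<close>.\<close>
  proof (rule left_orderable_inj_hom[OF hall.left_ordering_hall])
    show "h \<in> hom G coded_group" "inj_on h (carrier G)"
      using h by (auto simp: iso_def hom_def bij_betw_def)
    show "group G" using G by (simp add: computable_group_def)
  qed
  moreover have False
    if H: "computable_group H" "H \<cong> G" "left_ordering H R" "computable_rel R" for H :: "nat monoid" and R
  proof -
    have "H \<cong> hall.word_group" using H(2) G(2) by (rule iso_trans)
    then obtain \<theta> where "\<theta> \<in> iso H hall.word_group" by (auto simp: is_iso_def)
    with H(1) show False using H(3,4) by (rule no_computable_left_ordering)
  qed
  ultimately show ?thesis using G(1) by blast
qed

end
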